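(* Let $k$ be a field with $\operatorname{char}(k) = 0$. Then $\operatorname{dc}(xy^2 + yt^2 + z^3) = 5$, where $xy^2+yt^2+z^3 \in k[x,y,z,t]$.
   Context: For $m\ge1$, $\det_m$ is the determinant polynomial of an $m\times m$ matrix of indeterminates. For $f \in k[x_1,\ldots,x_n]$, a determinantal expression of size $m$ for $f$ is an affine linear map $L\colon k^n \to k^{m\times m}$ with $f(x) = \det_m(L(x))$; the determinantal complexity $\operatorname{dc}(f)$ is the smallest $m$ for which such an expression exists. *)

theory Defs
  imports
    "HOL-Library.Poly_Mapping"
    "HOL-Library.FuncSet"
    "Jordan_Normal_Form.Determinant"
begin

text \<open>
  Polynomials over \<open>'a\<close> in indeterminates indexed by natural numbers: a monomial is its finitely
  supported exponent vector. The ring \<open>k[x\<^sub>1, \<dots>, x\<^sub>n]\<close> consists of the polynomials involving only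
  the indeterminates \<open>0, \<dots>, n - 1\<close>.
\<close>

type_synonym 'a mpoly = "(nat \<Rightarrow>\<^sub>0 nat) \<Rightarrow>\<^sub>0 'a"

definition mconst :: "'a \<Rightarrow> 'a::comm_ring_1 mpoly" where
  "mconst c = Poly_Mapping.single 0 c"

definition indet :: "nat \<Rightarrow> 'a::comm_ring_1 mpoly" where
  "indet i = Poly_Mapping.single (Poly_Mapping.single i 1) 1"

definition linear_vec_mat :: "nat \<Rightarrow> nat \<Rightarrow> ('a::field vec \<Rightarrow> 'a mat) \<Rightarrow> bool" where
  "linear_vec_mat n m M \<longleftrightarrow>
     M \<in> carrier_vec n \<rightarrow> carrier_mat m m \<and>
     (\<forall>u\<in>carrier_vec n. \<forall>v\<in>carrier_vec n. M (u + v) = M u + M v) \<and>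
     (\<forall>c. \<forall>v\<in>carrier_vec n. M (c \<cdot>\<^sub>v v) = c \<cdot>\<^sub>m M v)"

definition affine_vec_mat :: "nat \<Rightarrow> nat \<Rightarrow> ('a::field vec \<Rightarrow> 'a mat) \<Rightarrow> bool" where
  "affine_vec_mat n m L \<longleftrightarrow>
     (\<exists>M. \<exists>B\<in>carrier_mat m m. linear_vec_mat n m M \<and> (\<forall>v\<in>carrier_vec n. L v = M v + B))"

text \<open>
  The identity \<open>f(x) = det\<^sub>m(L(x))\<close> is one of polynomials, so \<open>L\<close> has to be evaluated at the vector of
  indeterminates: if \<open>L v = B + (\<Sum>l<n. v\<^sub>l \<cdot> A\<^sub>l)\<close>, then \<open>L(x)\<close> is the matrix \<open>B + (\<Sum>l<n. x\<^sub>l \<cdot> A\<^sub>l)\<close> of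
  polynomials. The coefficients are recovered as \<open>B = L 0\<close> and \<open>A\<^sub>l = L e\<^sub>l - L 0\<close>.
\<close>

definition generic_value :: "nat \<Rightarrow> nat \<Rightarrow> ('a::field vec \<Rightarrow> 'a mat) \<Rightarrow> 'a mpoly mat" where
  "generic_value n m L = mat m m (\<lambda>(i, j).
     mconst (L (0\<^sub>v n) $$ (i, j)) +
     (\<Sum>l<n. mconst ((L (unit_vec n l) - L (0\<^sub>v n)) $$ (i, j)) * indet l))"

definition determinantal_expression ::
    "nat \<Rightarrow> nat \<Rightarrow> 'a::field mpoly \<Rightarrow> ('a vec \<Rightarrow> 'a mat) \<Rightarrow> bool" where
  "determinantal_expression n m f L \<longleftrightarrow> affine_vec_mat n m L \<and> f = det (generic_value n m L)"

text \<open>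
  The condition \<open>m \<ge> 1\<close> excludes the empty matrix, whose determinant is \<open>1\<close>. The minimum is meaningful
  because every polynomial in \<open>k[x\<^sub>1, \<dots>, x\<^sub>n]\<close> has a determinantal expression of some size.
\<close>

definition determinantal_complexity :: "nat \<Rightarrow> 'a::field mpoly \<Rightarrow> nat" where
  "determinantal_complexity n f = (LEAST m. 1 \<le> m \<and> (\<exists>L. determinantal_expression n m f L))"

end

theory Submission
  imports Defs "HOL-Library.Product_Plus"
begin

text \<open>
  Write \<open>F = x y\<^sup>2 + y t\<^sup>2 + z\<^sup>3\<close>. The cubic surface \<open>F = 0\<close> contains only one line, \<open>y = z = 0\<close>: if two
  linear forms \<open>p, q\<close> satisfy \<open>F \<in> (p, q)\<close>, then both lie in the span of \<open>y\<close> and \<open>z\<close>. On the other hand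
  \<open>F \<notin> (y, z)\<^sup>2\<close> because of the term \<open>y t\<^sup>2\<close>. An expression of size at most \<open>4\<close> gives, after padding with an
  identity block and normalising the constant part to \<open>diag(1, \<dots>, 1, 0, \<dots>, 0)\<close> of rank \<open>r\<close>, a matrix \<open>N\<close> of
  linear forms such that \<open>det (diag + s N)\<close> is a nonzero multiple of \<open>s\<^sup>3 F\<close>. For \<open>r = 0, 4\<close> this is absurd. For
  \<open>r = 2\<close> the lower \<open>2 \<times> 2\<close> block is singular, which puts \<open>F\<close> into a product of two ideals generated by two linear
  forms each. For \<open>r = 1\<close> one gets a \<open>3 \<times> 3\<close> linear determinant, excluded by the same idea after normalising
  its value at the singular point \<open>x\<close>. For \<open>r = 3\<close> one gets \<open>w u = 0\<close>, \<open>w M u = c F\<close>, \<open>w adj(M) u = 0\<close>; the first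
  equation is skew-symmetric and forces the entries of \<open>u\<close> or \<open>w\<close> into the span of \<open>y\<close> and \<open>z\<close>, and comparing
  coefficients then refutes the last one.
\<close>

section \<open>Linear forms and the line on the cubic\<close>

type_synonym 'a point = "'a \<times> 'a \<times> 'a \<times> 'a"

text \<open>Forms are functions on points rather than coefficient vectors: over an infinite field an
  identity of functions is one of polynomials, and restricting to a line or plane is just
  evaluation.\<close>

definition linear_form :: "('a::field point \<Rightarrow> 'a) \<Rightarrow> bool" where
  "linear_form p \<longleftrightarrow> (\<exists>a b c d. \<forall>x y z t. p (x, y, z, t) = a * x + b * y + c * z + d * t)"

definition cubic :: "'a::field point \<Rightarrow> 'a" where
  "cubic = (\<lambda>(x, y, z, t). x * y ^ 2 + y * t ^ 2 + z ^ 3)"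

lemma cubic_apply [simp]: "cubic (x, y, z, t) = x * y ^ 2 + y * t ^ 2 + z ^ 3"
  by (simp add: cubic_def)

lemma linear_form_expand:
  assumes "linear_form p"
  shows "p (x, y, z, t) = p (1,0,0,0) * x + p (0,1,0,0) * y + p (0,0,1,0) * z + p (0,0,0,1) * t"
  using assms by (auto simp: linear_form_def)

lemma linear_form_add: "linear_form p \<Longrightarrow> p (v + w) = p v + p w"
  by (cases v; cases w) (auto simp: linear_form_def algebra_simps)

lemma linear_form_plus:
  assumes "linear_form p" "linear_form q" shows "linear_form (\<lambda>v. p v + q v)"
proof -
  have "p (x, y, z, t) + q (x, y, z, t) = (p (1,0,0,0) + q (1,0,0,0)) * x +
    (p (0,1,0,0) + q (0,1,0,0)) * y + (p (0,0,1,0) + q (0,0,1,0)) * z +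
    (p (0,0,0,1) + q (0,0,0,1)) * t" for x y z t
    using linear_form_expand[OF assms(1), of x y z t] linear_form_expand[OF assms(2), of x y z t]
    by (simp add: algebra_simps)
  thus ?thesis unfolding linear_form_def by blast
qed

lemma linear_form_scale:
  assumes "linear_form p" shows "linear_form (\<lambda>v. c * p v)"
proof -
  have "c * p (x, y, z, t) = (c * p (1,0,0,0)) * x + (c * p (0,1,0,0)) * y +
    (c * p (0,0,1,0)) * z + (c * p (0,0,0,1)) * t" for x y z t
    using linear_form_expand[OF assms, of x y z t] by (simp add: algebra_simps)
  thus ?thesis unfolding linear_form_def by blast
qed

lemma linear_form_uminus: "linear_form p \<Longrightarrow> linear_form (\<lambda>v. - p v)"
  using linear_form_scale[of p "- 1"] by simp

lemma linear_form_minus: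
  "linear_form p \<Longrightarrow> linear_form q \<Longrightarrow> linear_form (\<lambda>v. p v - q v)"
  using linear_form_plus[of p "\<lambda>v. - q v"] by (simp add: linear_form_uminus)

lemmas linear_form_intros =
  linear_form_plus linear_form_minus linear_form_scale linear_form_uminus

lemma linear_form_coord:
  "linear_form (\<lambda>(x, y, z, t). x)" "linear_form (\<lambda>(x, y, z, t). y)"
  "linear_form (\<lambda>(x, y, z, t). z)" "linear_form (\<lambda>(x, y, z, t). t)"
  unfolding linear_form_def
  by (rule exI[of _ 1] exI[of _ 0], simp)+

text \<open>A field of characteristic zero is infinite, so a polynomial function that vanishes
  everywhere is the zero polynomial. Later comparisons of coefficients go through this, along a line
  or in one coordinate.\<close>

lemma quartic_coeffs_zero:
  fixes a b c d e :: "'a::field_char_0"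
  assumes "\<And>s. a + b * s + c * s ^ 2 + d * s ^ 3 + e * s ^ 4 = 0"
  shows "a = 0" "b = 0" "c = 0" "d = 0" "e = 0"
proof -
  have "poly [:a, b, c, d, e:] s = 0" for s
    using assms[of s] by (simp add: algebra_simps power_numeral_reduce)
  hence "[:a, b, c, d, e:] = 0"
    using poly_all_0_iff_0 by blast
  thus "a = 0" "b = 0" "c = 0" "d = 0" "e = 0" by auto
qed

text \<open>If \<open>p v\<close> and \<open>q w\<close> are nonzero then \<open>q v = 0\<close> and
  \<open>p w = 0\<close>, so the product at \<open>v + w\<close> is
  \<open>p v * q w\<close>.\<close>

lemma linear_forms_prod_zero:
  assumes "linear_form p" "linear_form q" "\<And>v. p v * q v = 0"
  shows "(\<forall>v. p v = 0) \<or> (\<forall>v. q v = 0)"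
proof (rule ccontr)
  assume "\<not> ?thesis"
  then obtain v w where *: "p v \<noteq> 0" "q w \<noteq> 0" by auto
  hence "q v = 0" "p w = 0" using assms(3)[of v] assms(3)[of w] by auto
  thus False using assms(3)[of "v + w"] * assms(1,2) by (simp add: linear_form_add)
qed

text \<open>Unique factorisation of \<open>a * d = b * c\<close>, done by hand: correcting
  \<open>b\<close> and \<open>c\<close> by multiples of \<open>a\<close> so that they vanish at a
  point \<open>w\<close> with \<open>a w \<noteq> 0\<close> gives two forms with zero product. One
  of them being zero means proportional columns, the other proportional rows.\<close>

lemma linear_forms_det_zero:
  assumes "linear_form a" "linear_form b" "linear_form c" "linear_form d"
    and det: "\<And>v. a v * d v = b v * c v"
  obtains k where "(\<forall>v. b v = k * a v \<and> d v = k * c v) \<or> (\<forall>v. a v = k * b v \<and> c v = k * d v) \<or>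
    (\<forall>v. c v = k * a v \<and> d v = k * b v) \<or> (\<forall>v. a v = k * c v \<and> b v = k * d v)"
proof (cases "\<forall>v. a v = 0")
  case True
  hence "(\<forall>v. b v = 0) \<or> (\<forall>v. c v = 0)"
    using linear_forms_prod_zero[of b c] assms by (metis mult_zero_left)
  thus ?thesis using that[of 0] True by auto
next
  case False
  then obtain w where w: "a w \<noteq> 0" by auto
  define b' where "b' v = a w * b v - b w * a v" for v
  define c' where "c' v = a w * c v - c w * a v" for v
  have lin: "linear_form b'" "linear_form c'"
    unfolding b'_def c'_def using assms by (auto intro!: linear_form_intros)
  have "b' v * c' v = 0" for v
  proof -
    \<comment> \<open>The polarisation of \<open>a * d - b * c = 0\<close> at \<open>v\<close> and
      \<open>w\<close>.\<close>
    have "a w * d v + a v * d w - b w * c v - b v * c w = 0"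
      using det[of "v + w"] det[of v] det[of w] assms(1-4)
      by (simp add: linear_form_add algebra_simps)
    hence "a w * a v * (a w * d v + a v * d w - b w * c v - b v * c w) = 0" by simp
    moreover have "b' v * c' v = a w * a w * (b v * c v) - a w * a v * (b w * c v + b v * c w) + a v * a v * (b w * c w)"
      by (simp add: b'_def c'_def algebra_simps)
    ultimately show ?thesis unfolding det[symmetric] by (simp add: algebra_simps)
  qed
  from linear_forms_prod_zero[OF lin this]
  show ?thesis
  proof
    assume *: "\<forall>v. b' v = 0"
    have b: "b v = b w / a w * a v" for v
      using *[rule_format, of v] w by (simp add: b'_def field_simps)
    have "a v * (d v - b w / a w * c v) = 0" for v
      using det[of v] b[of v] by (simp add: algebra_simps)
    hence "\<forall>v. d v - b w / a w * c v = 0"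
      using linear_forms_prod_zero[OF assms(1) linear_form_minus[OF assms(4) linear_form_scale[OF assms(3)]]] False
      by blast
    hence "\<forall>v. d v = b w / a w * c v" by simp
    thus ?thesis using that[of "b w / a w"] b by blast
  next
    assume *: "\<forall>v. c' v = 0"
    have c: "c v = c w / a w * a v" for v
      using *[rule_format, of v] w by (simp add: c'_def field_simps)
    have "a v * (d v - c w / a w * b v) = 0" for v
      using det[of v] c[of v] by (simp add: algebra_simps)
    hence "\<forall>v. d v - c w / a w * b v = 0"
      using linear_forms_prod_zero[OF assms(1) linear_form_minus[OF assms(4) linear_form_scale[OF assms(2)]]] False
      by blast
    hence "\<forall>v. d v = c w / a w * b v" by simp
    thus ?thesis using that[of "c w / a w"] c by blast
  qed
qed

text \<open>The common zero space of \<open>p\<close> and \<open>q\<close> meets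
  \<open>y = 0\<close> in a direction that must have \<open>z = 0\<close>, since the cubic is
  \<open>z ^ 3\<close> there. If this direction is nonzero and the space has a point with
  \<open>y = 1\<close>, the cubic varies along it.\<close>

lemma cubic_zero_on_codim2:
  fixes p q :: "'a::field_char_0 point \<Rightarrow> 'a"
  assumes lin: "linear_form p" "linear_form q"
    and zero: "\<And>v. p v = 0 \<Longrightarrow> q v = 0 \<Longrightarrow> cubic v = 0"
  shows "p (1,0,0,0) = 0" "p (0,0,0,1) = 0" "q (1,0,0,0) = 0" "q (0,0,0,1) = 0"
proof -
  obtain a b c d where p: "\<And>x y z t. p (x, y, z, t) = a * x + b * y + c * z + d * t"
    using lin(1) unfolding linear_form_def by blast
  obtain a' b' c' d' where q: "\<And>x y z t. q (x, y, z, t) = a' * x + b' * y + c' * z + d' * t"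
    using lin(2) unfolding linear_form_def by blast
  have F: "x * y ^ 2 + y * t ^ 2 + z ^ 3 = 0"
    if "a * x + b * y + c * z + d * t = 0" "a' * x + b' * y + c' * z + d' * t = 0" for x y z t
    using zero[of "(x, y, z, t)"] that by (simp add: p q)
  \<comment> \<open>\<open>(X, d * a' - a * d', T)\<close> is the cross product of the coefficients
    of \<open>x, z, t\<close> in \<open>p\<close> and \<open>q\<close>, hence a common zero with
    \<open>y = 0\<close>.\<close>
  define X where "X = c * d' - d * c'"
  define T where "T = a * c' - c * a'"
  have "d * a' - a * d' = 0"
    using F[of X 0 "d * a' - a * d'" T] by (simp add: X_def T_def algebra_simps)
  hence Z: "d * a' = a * d'" by simp
  have XT: "a * X + d * T = 0" "a' * X + d' * T = 0"
    using Z by (simp_all add: X_def T_def algebra_simps)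
  \<comment> \<open>From a point with \<open>y = 1\<close>, moving by \<open>s\<close> times
    \<open>(X, 0, 0, T)\<close> changes the cubic by
    \<open>(X + 2 * t * T) * s + T ^ 2 * s ^ 2\<close>.\<close>
  have line: False if "X \<noteq> 0 \<or> T \<noteq> 0" "a * x + b + c * z + d * t = 0"
      "a' * x + b' + c' * z + d' * t = 0" for x z t
  proof -
    have "x + t ^ 2 + z ^ 3 + (X + 2 * t * T) * s + T ^ 2 * s ^ 2 + 0 * s ^ 3 + 0 * s ^ 4 = 0" for s
    proof -
      have "a * (x + s * X) + b * 1 + c * z + d * (t + s * T) = 0"
        "a' * (x + s * X) + b' * 1 + c' * z + d' * (t + s * T) = 0"
        using arg_cong[OF XT(1), of "\<lambda>r. s * r"] arg_cong[OF XT(2), of "\<lambda>r. s * r"] that(2,3)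
        by (simp_all add: algebra_simps)
      from F[OF this] show ?thesis by (simp add: power2_eq_square algebra_simps)
    qed
    from quartic_coeffs_zero(2,3)[OF this] show False using that by simp
  qed
  have X0: "X = 0"
  proof (rule ccontr)
    assume X: "X \<noteq> 0"
    show False
    \<comment> \<open>Cramer's solution with \<open>x = 0\<close> and \<open>y = 1\<close>; for
      \<open>T \<noteq> 0\<close> below, the one with \<open>t = 0\<close>.\<close>
    proof (rule line[of 0 "(d * b' - b * d') / X" "(b * c' - c * b') / X"])
      show "X \<noteq> 0 \<or> T \<noteq> 0" using X by simp
      have "b * X + c * (d * b' - b * d') + d * (b * c' - c * b') = 0"
        "b' * X + c' * (d * b' - b * d') + d' * (b * c' - c * b') = 0"
        by (simp_all add: X_def algebra_simps)
      thus "a * 0 + b + c * ((d * b' - b * d') / X) + d * ((b * c' - c * b') / X) = 0"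
        "a' * 0 + b' + c' * ((d * b' - b * d') / X) + d' * ((b * c' - c * b') / X) = 0"
        using X by (simp_all add: field_simps)
    qed
  qed
  have T0: "T = 0"
  proof (rule ccontr)
    assume T: "T \<noteq> 0"
    show False
    proof (rule line[of "(c * b' - b * c') / T" "(b * a' - a * b') / T" 0])
      show "X \<noteq> 0 \<or> T \<noteq> 0" using T by simp
      have "b * T + a * (c * b' - b * c') + c * (b * a' - a * b') = 0"
        "b' * T + a' * (c * b' - b * c') + c' * (b * a' - a * b') = 0"
        by (simp_all add: T_def algebra_simps)
      thus "a * ((c * b' - b * c') / T) + b + c * ((b * a' - a * b') / T) + d * 0 = 0"
        "a' * ((c * b' - b * c') / T) + b' + c' * ((b * a' - a * b') / T) + d' * 0 = 0"
        using T by (simp_all add: field_simps)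
    qed
  qed
  have minors: "c * d' = d * c'" "a * c' = c * a'" using X0 T0 by (simp_all add: X_def T_def)
  \<comment> \<open>The two coefficient triples are now proportional, so the points used here are
    common zeros at which the cubic is, up to sign, the cube of the coefficient in question.\<close>
  have "a = 0" using F[of c 0 "-a" 0] minors Z by (simp add: algebra_simps)
  moreover have "d = 0" using F[of 0 0 d "-c"] minors Z by (simp add: algebra_simps)
  moreover have "a' = 0" using F[of c' 0 "-a'" 0] minors Z by (simp add: algebra_simps)
  moreover have "d' = 0" using F[of 0 0 d' "-c'"] minors Z by (simp add: algebra_simps)
  ultimately show "p (1,0,0,0) = 0" "p (0,0,0,1) = 0" "q (1,0,0,0) = 0" "q (0,0,0,1) = 0"
    by (simp_all add: p q)
qed

text \<open>With the coordinate \<open>x\<close> as second form, \<open>x\<close> itself would have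
  to lie in the span of \<open>y\<close> and \<open>z\<close>.\<close>

lemma cubic_not_zero_on_hyperplane:
  fixes p :: "'a::field_char_0 point \<Rightarrow> 'a"
  assumes "linear_form p" "\<And>v. p v = 0 \<Longrightarrow> cubic v = 0"
  shows False
  using cubic_zero_on_codim2(3)[OF assms(1) linear_form_coord(1)] assms(2) by auto

text \<open>The cubic vanishes where \<open>w1, w2\<close> do and where \<open>u1, u2\<close> do, so
  all four lie in the span of \<open>y\<close> and \<open>z\<close>. On \<open>(0, s, 0, 1)\<close>
  the left side is \<open>k * s\<close>, but the right side is divisible by
  \<open>s ^ 2\<close>.\<close>

lemma cubic_not_in_line_ideal_squared:
  fixes w1 w2 u1 u2 h11 h12 h21 h22 :: "'a::field_char_0 point \<Rightarrow> 'a"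
  assumes lin: "linear_form w1" "linear_form w2" "linear_form u1" "linear_form u2"
    "linear_form h11" "linear_form h12" "linear_form h21" "linear_form h22"
    and "k \<noteq> 0"
    and eq: "\<And>v. k * cubic v = w1 v * (u1 v * h11 v + u2 v * h12 v) + w2 v * (u1 v * h21 v + u2 v * h22 v)"
  shows False
proof -
  have "cubic v = 0" if "w1 v = 0" "w2 v = 0" for v using eq[of v] that \<open>k \<noteq> 0\<close> by simp
  note w = cubic_zero_on_codim2(2,4)[OF lin(1,2) this]
  have "cubic v = 0" if "u1 v = 0" "u2 v = 0" for v using eq[of v] that \<open>k \<noteq> 0\<close> by simp
  note u = cubic_zero_on_codim2(2,4)[OF lin(3,4) this]
  have ex: "p (0, s, 0, 1) = p (0,1,0,0) * s + p (0,0,0,1)"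
    if "linear_form p" for p :: "'a point \<Rightarrow> 'a" and s
    using linear_form_expand[OF that, of 0 s 0 1] by simp
  let ?y = "(0,1,0,0) :: 'a point" and ?t = "(0,0,0,1) :: 'a point"
  let ?C = "\<lambda>e. w1 ?y * (u1 ?y * h11 e + u2 ?y * h12 e) + w2 ?y * (u1 ?y * h21 e + u2 ?y * h22 e)"
  have "0 + k * s + (- ?C ?t) * s ^ 2 + (- ?C ?y) * s ^ 3 + 0 * s ^ 4 = 0" for s
    using eq[of "(0, s, 0, 1)"] unfolding ex[OF lin(1), of s] ex[OF lin(2), of s] ex[OF lin(3), of s]
      ex[OF lin(4), of s] ex[OF lin(5), of s] ex[OF lin(6), of s] ex[OF lin(7), of s] ex[OF lin(8), of s]
    by (simp add: w u algebra_simps power2_eq_square power3_eq_cube)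
  from quartic_coeffs_zero(2)[OF this] \<open>k \<noteq> 0\<close> show False by simp
qed

section \<open>Constant part of rank three\<close>

text \<open>
  The coefficients of \<open>s\<^sup>2\<close>, \<open>s\<^sup>3\<close> and \<open>s\<^sup>4\<close> in the determinant of the \<open>4 \<times> 4\<close> matrix with blocks
  \<open>1 + s M\<close>, \<open>s u\<close>, \<open>s w\<close>, \<open>0\<close>, simplified with \<open>w u = 0\<close>.
\<close>

locale bordered =
  fixes k :: "'a::field_char_0"
    and w1 w2 w3 u1 u2 u3 m11 m12 m13 m21 m22 m23 m31 m32 m33 :: "'a point \<Rightarrow> 'a"
  assumes lin: "linear_form w1" "linear_form w2" "linear_form w3"
      "linear_form u1" "linear_form u2" "linear_form u3"
      "linear_form m11" "linear_form m12" "linear_form m13"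
      "linear_form m21" "linear_form m22" "linear_form m23"
      "linear_form m31" "linear_form m32" "linear_form m33"
    and k: "k \<noteq> 0"
    and deg2: "\<And>v. w1 v * u1 v + w2 v * u2 v + w3 v * u3 v = 0"
    and deg3: "\<And>v. w1 v * (m11 v * u1 v + m12 v * u2 v + m13 v * u3 v) +
      w2 v * (m21 v * u1 v + m22 v * u2 v + m23 v * u3 v) +
      w3 v * (m31 v * u1 v + m32 v * u2 v + m33 v * u3 v) = k * cubic v"
    and deg4: "\<And>v. 
      w1 v * ((m22 v * m33 v - m23 v * m32 v) * u1 v + (m13 v * m32 v - m12 v * m33 v) * u2 v +
        (m12 v * m23 v - m13 v * m22 v) * u3 v) +
      w2 v * ((m23 v * m31 v - m21 v * m33 v) * u1 v + (m11 v * m33 v - m13 v * m31 v) * u2 v +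
        (m13 v * m21 v - m11 v * m23 v) * u3 v) +
      w3 v * ((m21 v * m32 v - m22 v * m31 v) * u1 v + (m12 v * m31 v - m11 v * m32 v) * u2 v +
        (m11 v * m22 v - m12 v * m21 v) * u3 v) = 0"
begin

text \<open>Renumbering rows and columns simultaneously, as here and next, and transposing preserve
  all hypotheses; the later reductions to one case rest on these symmetries.\<close>

lemma swap12: "bordered k w2 w1 w3 u2 u1 u3 m22 m21 m23 m12 m11 m13 m32 m31 m33"
proof (unfold_locales; (intro lin k)?)
  fix v
  show "w2 v * u2 v + w1 v * u1 v + w3 v * u3 v = 0"
    using deg2[of v] by (simp add: algebra_simps)
  show "w2 v * (m22 v * u2 v + m21 v * u1 v + m23 v * u3 v) +
      w1 v * (m12 v * u2 v + m11 v * u1 v + m13 v * u3 v) +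
      w3 v * (m32 v * u2 v + m31 v * u1 v + m33 v * u3 v) = k * cubic v"
    using deg3[of v] by (simp add: algebra_simps)
qed (use deg4 in \<open>simp add: algebra_simps\<close>)

lemma swap23: "bordered k w1 w3 w2 u1 u3 u2 m11 m13 m12 m31 m33 m32 m21 m23 m22"
proof (unfold_locales; (intro lin k)?)
  fix v
  show "w1 v * u1 v + w3 v * u3 v + w2 v * u2 v = 0"
    using deg2[of v] by (simp add: algebra_simps)
  show "w1 v * (m11 v * u1 v + m13 v * u3 v + m12 v * u2 v) +
      w3 v * (m31 v * u1 v + m33 v * u3 v + m32 v * u2 v) +
      w2 v * (m21 v * u1 v + m23 v * u3 v + m22 v * u2 v) = k * cubic v"
    using deg3[of v] by (simp add: algebra_simps)
qed (use deg4 in \<open>simp add: algebra_simps\<close>)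

lemma transpose: "bordered k u1 u2 u3 w1 w2 w3 m11 m21 m31 m12 m22 m32 m13 m23 m33"
proof (unfold_locales; (intro lin k)?)
  fix v
  show "u1 v * w1 v + u2 v * w2 v + u3 v * w3 v = 0"
    using deg2[of v] by (simp add: algebra_simps)
  show "u1 v * (m11 v * w1 v + m21 v * w2 v + m31 v * w3 v) +
      u2 v * (m12 v * w1 v + m22 v * w2 v + m32 v * w3 v) +
      u3 v * (m13 v * w1 v + m23 v * w2 v + m33 v * w3 v) = k * cubic v"
    using deg3[of v] by (simp add: algebra_simps)
qed (use deg4 in \<open>simp add: algebra_simps\<close>)

text \<open>Conjugation of \<open>M\<close> by an elementary matrix, which leaves the constant part unchanged.\<close>

lemma shear: "bordered k (\<lambda>v. w1 v + l * w3 v) w2 w3 u1 u2 (\<lambda>v. u3 v - l * u1 v)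
   (\<lambda>v. m11 v + l * m13 v) m12 m13 (\<lambda>v. m21 v + l * m23 v) m22 m23
   (\<lambda>v. m31 v + l * m33 v - l * (m11 v + l * m13 v)) (\<lambda>v. m32 v - l * m12 v) (\<lambda>v. m33 v - l * m13 v)"
proof (unfold_locales; (intro lin k linear_form_intros)?)
  fix v
  show "(w1 v + l * w3 v) * u1 v + w2 v * u2 v + w3 v * (u3 v - l * u1 v) = 0"
    using deg2[of v] by (simp add: algebra_simps)
  show "(w1 v + l * w3 v) * ((m11 v + l * m13 v) * u1 v + m12 v * u2 v + m13 v * (u3 v - l * u1 v)) +
         w2 v * ((m21 v + l * m23 v) * u1 v + m22 v * u2 v + m23 v * (u3 v - l * u1 v)) +
         w3 v *
         ((m31 v + l * m33 v - l * (m11 v + l * m13 v)) * u1 v + (m32 v - l * m12 v) * u2 v +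
          (m33 v - l * m13 v) * (u3 v - l * u1 v)) = k * cubic v"
    using deg3[of v] by (simp add: algebra_simps)
qed (use deg4 in \<open>simp add: algebra_simps\<close>)


lemma cubic_zero: "u1 v = 0 \<Longrightarrow> u2 v = 0 \<Longrightarrow> u3 v = 0 \<Longrightarrow> cubic v = 0"
  using deg3[of v] k by simp

text \<open>The equation \<open>w u = 0\<close> makes \<open>w1\<close> a multiple of
  \<open>z\<close> and \<open>w2\<close> a multiple of \<open>y\<close>. The degree 3 identity on
  \<open>z = 0\<close> and on \<open>y = 0\<close> restricts \<open>w3\<close>, \<open>m31\<close>,
  \<open>m32\<close> and \<open>m12\<close> so far that the degree 4 identity on
  \<open>y = 0\<close> is left with a nonzero term \<open>d * g * R\<close>.\<close>

lemma no_normalised_column: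
  assumes u: "\<And>x y z t. u1 (x, y, z, t) = al * y" "\<And>x y z t. u2 (x, y, z, t) = be * z"
      "\<And>v. u3 v = 0"
    and ne: "al \<noteq> 0" "be \<noteq> 0"
  shows False
proof -
  note ex = linear_form_expand
  have w2: "w2 (x, 0, z, t) = 0" for x z t
  proof -
    have "w2 (x, 0, 1, t) = 0" for x t
      using deg2[of "(x, 0, 1, t)"] u ne by simp
    from this[of 0 0] this[of 1 0] this[of 0 1] ex[OF lin(2), of 1 0 1 0]
      ex[OF lin(2), of 0 0 1 1] ex[OF lin(2), of x 0 z t]
    show ?thesis by simp
  qed
  define nu where "nu = w2 (0,1,0,0)"
  have w2': "w2 (x, y, 0, t) = nu * y" for x y t
    using ex[OF lin(2), of x y 0 t] w2[of 1 0 0] w2[of 0 0 1] by (simp add: nu_def)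
  define ka where "ka = w1 (0,0,1,0)"
  have w1: "w1 (x, y, z, t) = ka * z" for x y z t
  proof -
    have "w1 (x, 1, 0, t) = 0" for x t
      using deg2[of "(x, 1, 0, t)"] u ne by simp
    from this[of 0 0] this[of 1 0] this[of 0 1] ex[OF lin(1), of 1 1 0 0]
      ex[OF lin(1), of 0 1 0 1] ex[OF lin(1), of x y z t]
    show ?thesis by (simp add: ka_def)
  qed
  obtain a b' b d where w3: "\<And>x y z t. w3 (x, y, z, t) = a * x + b' * y + b * z + d * t"
    using lin(3) unfolding linear_form_def by blast
  obtain P Q' Q R where m31: "\<And>x y z t. m31 (x, y, z, t) = P * x + Q' * y + Q * z + R * t"
    using lin(13) unfolding linear_form_def by blast
  obtain p q' q r where m32: "\<And>x y z t. m32 (x, y, z, t) = p * x + q' * y + q * z + r * t"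
    using lin(14) unfolding linear_form_def by blast
  obtain e g' g h where m12: "\<And>x y z t. m12 (x, y, z, t) = e * x + g' * y + g * z + h * t"
    using lin(8) unfolding linear_form_def by blast
  obtain i1 i2 i3 i4 where m21: "\<And>x y z t. m21 (x, y, z, t) = i1 * x + i2 * y + i3 * z + i4 * t"
    using lin(10) unfolding linear_form_def by blast
  obtain j1 j2 j3 j4 where m33: "\<And>x y z t. m33 (x, y, z, t) = j1 * x + j2 * y + j3 * z + j4 * t"
    using lin(15) unfolding linear_form_def by blast
  obtain n1 n2 n3 n4 where m11: "\<And>x y z t. m11 (x, y, z, t) = n1 * x + n2 * y + n3 * z + n4 * t"
    using lin(7) unfolding linear_form_def by blast

  \<comment> \<open>Coefficient of \<open>y\<close> on \<open>z = 0\<close>: two forms in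
    \<open>x, t\<close> multiply to a nonzero multiple of \<open>t ^ 2\<close>, so both are
    multiples of \<open>t\<close>.\<close>
  have A: "al * (a * x + d * t) * (P * x + R * t) = k * t ^ 2" for x t
  proof -
    have "0 + (al * (a * x + d * t) * (P * x + R * t) - k * t ^ 2) * y +
       (al * (nu * (i1 * x + i4 * t) + b' * (P * x + R * t) + (a * x + d * t) * Q') - k * x) * y ^ 2 +
       (al * (nu * i2 + b' * Q')) * y ^ 3 + 0 * y ^ 4 = 0" for y
      using deg3[of "(x, y, 0, t)"]
      by (simp add: w1 w2' u w3 m21 m31 algebra_simps power2_eq_square power3_eq_cube)
    from quartic_coeffs_zero(2)[OF this] show ?thesis by simp
  qed
  have "(al * d * R - k) + (al * (a * R + d * P)) * x + (al * a * P) * x ^ 2 + 0 * x ^ 3 + 0 * x ^ 4 = 0" for x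
    using A[of x 1] by (simp add: algebra_simps power2_eq_square)
  note * = quartic_coeffs_zero(1,2,3)[OF this]
  have dR: "d \<noteq> 0" "R \<noteq> 0" using *(1) k by auto
  have aP: "a = 0" "P = 0" using *(2,3) ne dR by auto

  \<comment> \<open>On \<open>y = 0\<close> only \<open>w1\<close>, \<open>w3\<close> and
    \<open>u2\<close> survive, and the cubic is \<open>z ^ 3\<close>.\<close>
  have B: "be * d * t * (p * x + r * t) = 0" "ka * (e * x + h * t) + b * (p * x + r * t) + d * t * q = 0"
     "be * (ka * g + b * q) = k" for x t
  proof -
    have eq: "0 + (be * d * t * (p * x + r * t)) * z +
       (be * (ka * (e * x + h * t) + b * (p * x + r * t) + d * t * q)) * z ^ 2 +
       (be * (ka * g + b * q) - k) * z ^ 3 + 0 * z ^ 4 = 0" for z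
      using deg3[of "(x, 0, z, t)"]
      by (simp add: w1 w2 u w3 m32 m12 aP algebra_simps power2_eq_square power3_eq_cube)
    show "be * d * t * (p * x + r * t) = 0" using quartic_coeffs_zero(2)[OF eq] .
    show "ka * (e * x + h * t) + b * (p * x + r * t) + d * t * q = 0"
      using quartic_coeffs_zero(3)[OF eq] ne by simp
    show "be * (ka * g + b * q) = k" using quartic_coeffs_zero(4)[OF eq] by simp
  qed
  have "r = 0" using B(1)[of 1 0] dR ne by simp
  moreover from this have "p = 0" using B(1)[of 1 1] dR ne by simp
  ultimately have pr: "p = 0" "r = 0" by auto
  \<comment> \<open>The left side of \<open>deg4\<close> on \<open>y = 0\<close> with the factor
    \<open>u2 = be * z\<close> taken out.\<close>
  define J where "J x z t = ka * z * (m13 (x, 0, z, t) * q * z - (e * x + g * z + h * t) * (j1 * x + j3 * z + j4 * t))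
     + (b * z + d * t) * ((e * x + g * z + h * t) * (Q * z + R * t) - (n1 * x + n3 * z + n4 * t) * (q * z))" for x z t
  have "be * (z * J x z t) = 0" for x z t
    using deg4[of "(x, 0, z, t)"]
    by (simp add: w1 w2 u w3 m32 m12 m11 m33 m31 aP pr J_def algebra_simps)
  hence D: "z * J x z t = 0" for x z t using ne by simp
  obtain l1 l2 l3 l4 where m13: "\<And>x y z t. m13 (x, y, z, t) = l1 * x + l2 * y + l3 * z + l4 * t"
    using lin(9) unfolding linear_form_def by blast
  have C: "d * (e * x + h) * R = 0" for x
  proof -
    have "0 + (d * (e * x + h) * R) * z + 
     (ka * (- (e * x + h) * (j1 * x + j4)) + b * (e * x + h) * R + d * (g * R + (e * x + h) * Q - (n1 * x + n4) * q)) * z ^ 2 +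
     (ka * ((l1 * x + l4) * q - (e * x + h) * j3 - g * (j1 * x + j4)) + b * (g * R + (e * x + h) * Q - (n1 * x + n4) * q) + d * (g * Q - n3 * q)) * z ^ 3 +
     (ka * (l3 * q - g * j3) + b * (g * Q - n3 * q)) * z ^ 4 = 0" for z
      using D[of z x 1]
      by (simp add: J_def m13 algebra_simps power_numeral_reduce)
    from quartic_coeffs_zero(2)[OF this] show ?thesis .
  qed
  have h: "h = 0" using C[of 0] dR by simp
  have e: "e = 0" using C[of 1] h dR by simp
  have q: "q = 0" using B(2)[of 0 1] h pr dR by simp
  have g: "g \<noteq> 0" using B(3) q k by auto
  \<comment> \<open>With \<open>e\<close>, \<open>h\<close> and \<open>q\<close> zero, the lowest
    term at \<open>x = 0\<close>, \<open>t = 1\<close> has three nonzero factors.\<close>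
  have "0 + 0 * z + (d * g * R) * z ^ 2 + (g * (b * R + d * Q - ka * j4)) * z ^ 3 + (g * (b * Q - ka * j3)) * z ^ 4 = 0" for z
    using D[of z 0 1]
    by (simp add: J_def q h e algebra_simps power_numeral_reduce)
  from quartic_coeffs_zero(3)[OF this] dR g show False by simp
qed

end

section \<open>Kernels of small matrices\<close>

lemma sum_lessThan3: "(\<Sum>i = 0..<3::nat. f i) = f 0 + f 1 + (f 2 :: 'a::comm_monoid_add)"
  by (simp add: eval_nat_numeral)

lemma sum_lessThan4: "(\<Sum>i = 0..<4::nat. f i) = f 0 + f 1 + f 2 + (f 3 :: 'a::comm_monoid_add)"
  by (simp add: eval_nat_numeral add.assoc)

lemma less3_cases: "(i::nat) < 3 \<Longrightarrow> i = 0 \<or> i = 1 \<or> i = 2" by auto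

lemma less4_cases: "(i::nat) < 4 \<Longrightarrow> i = 0 \<or> i = 1 \<or> i = 2 \<or> i = 3" by auto

text \<open>Three equations in four unknowns: a zero row completes the coefficients to a singular
  square matrix, and a kernel vector is the point.\<close>

lemma linear_forms_common_zero:
  fixes p q r :: "'a::field point \<Rightarrow> 'a"
  assumes "linear_form p" "linear_form q" "linear_form r"
  obtains v where "v \<noteq> 0" "p v = 0" "q v = 0" "r v = 0"
proof -
  define E where "E j = ([(1,0,0,0), (0,1,0,0), (0,0,1,0), (0,0,0,1)] ! j :: 'a point)" for j
  define A where "A = mat 4 4 (\<lambda>(i, j). [p (E j), q (E j), r (E j), 0] ! i)"
  have A: "A \<in> carrier_mat 4 4" by (simp add: A_def)
  have "transpose_mat A *\<^sub>v unit_vec 4 3 = 0\<^sub>v 4"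
    by (rule eq_vecI) (auto simp: A_def scalar_prod_def sum_lessThan4)
  moreover have "unit_vec 4 3 \<noteq> (0\<^sub>v 4 :: 'a vec)" by simp
  ultimately have "det (transpose_mat A) = 0"
    using det_0_iff_vec_prod_zero_field[of "transpose_mat A" 4] A
    by (metis transpose_carrier_mat unit_vec_carrier)
  hence "det A = 0" using det_transpose[OF A] by simp
  then obtain c where c: "c \<in> carrier_vec 4" "c \<noteq> 0\<^sub>v 4" "A *\<^sub>v c = 0\<^sub>v 4"
    using det_0_iff_vec_prod_zero_field[OF A] by auto
  define v where "v = (c $ 0, c $ 1, c $ 2, c $ 3)"
  have "s v = s (E 0) * c $ 0 + s (E 1) * c $ 1 + s (E 2) * c $ 2 + s (E 3) * c $ 3"
    if "linear_form s" for s
    unfolding v_def E_def by (subst linear_form_expand[OF that]) simp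
  note ex = this
  have row: "(A *\<^sub>v c) $ i = A $$ (i,0) * c $ 0 + A $$ (i,1) * c $ 1 + A $$ (i,2) * c $ 2 + A $$ (i,3) * c $ 3"
    if "i < 4" for i
    using that c(1) A by (auto simp: scalar_prod_def sum_lessThan4)
  have row0: "A $$ (i,0) * c $ 0 + A $$ (i,1) * c $ 1 + A $$ (i,2) * c $ 2 + A $$ (i,3) * c $ 3 = 0"
    if "i < 4" for i using row[OF that] c(3) that by simp
  have "p v = 0" using row0[of 0] ex[OF assms(1)] by (simp add: A_def)
  moreover have "q v = 0" using row0[of 1] ex[OF assms(2)] by (simp add: A_def)
  moreover have "r v = 0" using row0[of 2] ex[OF assms(3)] by (simp add: A_def)
  moreover have "v \<noteq> 0"
  proof
    assume "v = 0"
    hence "c $ i = 0" if "i < 4" for i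
      using that less4_cases[of i] by (auto simp: v_def zero_prod_def)
    hence "c = 0\<^sub>v 4" using c(1) by (intro eq_vecI) auto
    with c(2) show False by simp
  qed
  ultimately show ?thesis using that by blast
qed

text \<open>Transposing a skew-symmetric matrix of odd order 3 gives \<open>det K = - det K\<close>,
  and 2 is nonzero.\<close>

lemma singular_or_singular_of_skew:
  fixes W U :: "'a::field_char_0 mat"
  assumes W: "W \<in> carrier_mat 3 3" and U: "U \<in> carrier_mat 3 3"
    and skew: "transpose_mat (transpose_mat W * U) = - (transpose_mat W * U)"
  shows "det W = 0 \<or> det U = 0"
proof -
  let ?K = "transpose_mat W * U"
  have K: "?K \<in> carrier_mat 3 3" using W U by simp
  have "- ?K = (- 1) \<cdot>\<^sub>m ?K" by (intro eq_matI) auto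
  hence "det ?K = (- 1) ^ 3 * det ?K"
    using det_transpose[OF K] skew det_smult[of "- 1" ?K] K U by auto
  hence "2 * det ?K = 0" by simp
  hence "det ?K = 0" by simp
  thus ?thesis using det_mult[of "transpose_mat W" 3 U] W U det_transpose[OF W] by simp
qed

lemma left_kernel3:
  fixes A :: "'a::field mat"
  assumes A: "A \<in> carrier_mat 3 3" and "det A = 0"
  obtains a b c where "a \<noteq> 0 \<or> b \<noteq> 0 \<or> c \<noteq> 0"
    "\<And>j. j < 3 \<Longrightarrow> a * A $$ (0, j) + b * A $$ (1, j) + c * A $$ (2, j) = 0"
proof -
  have "det (transpose_mat A) = 0" using assms det_transpose by metis
  then obtain v where v: "v \<in> carrier_vec 3" "v \<noteq> 0\<^sub>v 3" "transpose_mat A *\<^sub>v v = 0\<^sub>v 3"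
    using det_0_iff_vec_prod_zero_field[of "transpose_mat A" 3] A by auto
  have "v $ 0 * A $$ (0, j) + v $ 1 * A $$ (1, j) + v $ 2 * A $$ (2, j) = 0" if "j < 3" for j
  proof -
    have "(transpose_mat A *\<^sub>v v) $ j = 0" using v that by simp
    thus ?thesis using that v(1) A by (simp add: scalar_prod_def sum_lessThan3 algebra_simps)
  qed
  moreover have "v $ 0 \<noteq> 0 \<or> v $ 1 \<noteq> 0 \<or> v $ 2 \<noteq> 0"
  proof (rule ccontr)
    assume "\<not> ?thesis"
    hence "v $ i = 0" if "i < 3" for i
      using that less3_cases[of i] by auto
    hence "v = 0\<^sub>v 3" using v(1) by (intro eq_vecI) auto
    with v(2) show False by simp
  qed
  ultimately show ?thesis using that by blast
qed

section \<open>Reducing the column \<open>u\<close>, and the contradiction in rank three\<close>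

context bordered
begin

lemma shear2: "bordered k w1 (\<lambda>v. w2 v + l * w3 v) w3 u1 u2 (\<lambda>v. u3 v - l * u2 v)
   m11 (\<lambda>v. m12 v + l * m13 v) m13 m21 (\<lambda>v. m22 v + l * m23 v) m23
   (\<lambda>v. m31 v - l * m21 v) (\<lambda>v. m32 v + l * m33 v - l * (m22 v + l * m23 v)) (\<lambda>v. m33 v - l * m23 v)"
  using bordered.swap12[OF bordered.shear[OF swap12, of l]] .

lemma swap13: "bordered k w3 w2 w1 u3 u2 u1 m33 m32 m31 m23 m22 m21 m13 m12 m11"
  using bordered.swap12[OF bordered.swap23[OF swap12]] .

text \<open>Two shears with \<open>u1 = al * y\<close> as pivot clear the terms
  \<open>de * y\<close> and \<open>ga * y\<close>.\<close>

lemma no_triangular_column: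
  assumes u: "\<And>x y z t. u1 (x, y, z, t) = al * y" "\<And>x y z t. u2 (x, y, z, t) = be * z + ga * y"
      "\<And>x y z t. u3 (x, y, z, t) = de * y"
    and ne: "al \<noteq> 0" "be \<noteq> 0"
  shows False
proof (rule bordered.no_normalised_column[OF bordered.swap23[OF bordered.shear[OF bordered.swap23[OF shear]]]])
  show "u2 (x, y, z, t) - ga / al * u1 (x, y, z, t) = be * z" for x y z t using u ne by simp
  show "u3 v - de / al * u1 v = 0" for v using u ne by (cases v) simp
qed (use u ne in auto)

text \<open>Subtracting multiples of \<open>u2\<close>, which contains \<open>z\<close>, turns
  \<open>u1\<close> and \<open>u3\<close> into multiples of \<open>y\<close>. If one is nonzero, the
  column is triangular up to order; if both vanish, the cubic vanishes on the hyperplane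
  \<open>u2 = 0\<close>.\<close>

lemma no_column_in_yz_aux:
  assumes u: "\<And>x y z t. u1 (x, y, z, t) = a1 * y + b1 * z" "\<And>x y z t. u2 (x, y, z, t) = a2 * y + b2 * z"
      "\<And>x y z t. u3 (x, y, z, t) = a3 * y + b3 * z"
    and ne: "b2 \<noteq> 0"
  shows False
proof -
  let ?u1 = "\<lambda>v. u1 v - b1 / b2 * u2 v" and ?u3 = "\<lambda>v. u3 v - b3 / b2 * u2 v"
  note sheared = bordered.shear2[OF bordered.swap13[OF shear2[of "b3 / b2"]], of "b1 / b2"]
  let ?c1 = "a1 - b1 / b2 * a2" and ?c3 = "a3 - b3 / b2 * a2"
  have u1': "?u1 (x, y, z, t) = ?c1 * y" and u3': "?u3 (x, y, z, t) = ?c3 * y" for x y z t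
    using ne u by (simp_all add: field_simps)
  have u2': "u2 (x, y, z, t) = b2 * z + a2 * y" for x y z t using u by simp
  consider "?c1 \<noteq> 0" | "?c3 \<noteq> 0" | "?c1 = 0" "?c3 = 0" by blast
  thus False
  proof cases
    case 1
    show False
      by (rule bordered.no_triangular_column[OF bordered.swap13[OF sheared] u1' u2' u3' 1 ne])
  next
    case 2
    show False
      by (rule bordered.no_triangular_column[OF sheared u3' u2' u1' 2 ne])
  next
    case 3
    have "u1 v = b1 / b2 * u2 v" "u3 v = b3 / b2 * u2 v" for v
      using u1' u3' 3 by (cases v, simp)+
    hence "u2 v = 0 \<Longrightarrow> cubic v = 0" for v using cubic_zero[of v] by simp
    thus False using cubic_not_zero_on_hyperplane[OF lin(5)] by blast
  qed
qed

text \<open>The cubic is nonzero at \<open>(0,0,1,0)\<close>, so some entry of the column contains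
  \<open>z\<close>; a renumbering makes it the second.\<close>

lemma no_column_in_yz:
  assumes u: "u1 (1,0,0,0) = 0" "u1 (0,0,0,1) = 0" "u2 (1,0,0,0) = 0" "u2 (0,0,0,1) = 0"
    "u3 (1,0,0,0) = 0" "u3 (0,0,0,1) = 0"
  shows False
proof -
  define a b where "a p = p (0,1,0,0)" and "b p = p (0,0,1,0)" for p :: "'a point \<Rightarrow> 'a"
  have u: "u1 (x, y, z, t) = a u1 * y + b u1 * z" "u2 (x, y, z, t) = a u2 * y + b u2 * z"
    "u3 (x, y, z, t) = a u3 * y + b u3 * z" for x y z t
    using linear_form_expand[OF lin(4), of x y z t] linear_form_expand[OF lin(5), of x y z t]
      linear_form_expand[OF lin(6), of x y z t] u by (simp_all add: a_def b_def)
  consider "b u1 \<noteq> 0" | "b u2 \<noteq> 0" | "b u3 \<noteq> 0" | "b u1 = 0" "b u2 = 0" "b u3 = 0" by blast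
  thus False
  proof cases
    case 1
    show False by (rule bordered.no_column_in_yz_aux[OF swap12 u(2,1,3) 1])
  next
    case 2
    show False by (rule no_column_in_yz_aux[OF u 2])
  next
    case 3
    show False by (rule bordered.no_column_in_yz_aux[OF swap23 u(1,3,2) 3])
  next
    case 4
    have "cubic (0,0,1,0) = 0" using cubic_zero[of "(0,0,1,0)"] u 4 by simp
    thus False by simp
  qed
qed

text \<open>The cubic vanishes where \<open>u1\<close> and \<open>u2\<close> do, which puts these
  two, and with them \<open>u3\<close>, into the span of \<open>y\<close> and
  \<open>z\<close>.\<close>

lemma no_dependent_column_aux:
  assumes u3: "\<And>v. u3 v = l * u1 v + m * u2 v"
  shows False
proof -
  have "cubic v = 0" if "u1 v = 0" "u2 v = 0" for v using cubic_zero[of v] that u3 by simp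
  note * = cubic_zero_on_codim2[OF lin(4,5) this]
  show False using no_column_in_yz * u3 by simp
qed

lemma no_dependent_column:
  assumes ne: "a \<noteq> 0 \<or> b \<noteq> 0 \<or> c \<noteq> 0" and rel: "\<And>v. a * u1 v + b * u2 v + c * u3 v = 0"
  shows False
proof -
  consider "a \<noteq> 0" | "b \<noteq> 0" | "c \<noteq> 0" using ne by blast
  thus False
  proof cases
    case 1
    have "u1 v = (- c / a) * u3 v + (- b / a) * u2 v" for v
    proof -
      have "a * u1 v = - (b * u2 v + c * u3 v)"
        using rel[of v] by (simp add: eq_neg_iff_add_eq_0 algebra_simps)
      thus ?thesis using 1 by (simp add: field_simps)
    qed
    thus False by (rule bordered.no_dependent_column_aux[OF swap13])
  next
    case 2
    have "u2 v = (- a / b) * u1 v + (- c / b) * u3 v" for v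
    proof -
      have "b * u2 v = - (a * u1 v + c * u3 v)"
        using rel[of v] by (simp add: eq_neg_iff_add_eq_0 algebra_simps)
      thus ?thesis using 2 by (simp add: field_simps)
    qed
    thus False by (rule bordered.no_dependent_column_aux[OF swap23])
  next
    case 3
    have "u3 v = (- a / c) * u1 v + (- b / c) * u2 v" for v
    proof -
      have "c * u3 v = - (a * u1 v + b * u2 v)"
        using rel[of v] by (simp add: eq_neg_iff_add_eq_0 algebra_simps)
      thus ?thesis using 3 by (simp add: field_simps)
    qed
    thus False by (rule no_dependent_column_aux)
  qed
qed

lemma polar: "w1 v * u1 v' + w1 v' * u1 v + w2 v * u2 v' + w2 v' * u2 v + w3 v * u3 v' + w3 v' * u3 v = 0"
proof -
  have "w1 (v + v') * u1 (v + v') + w2 (v + v') * u2 (v + v') + w3 (v + v') * u3 (v + v') -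
    (w1 v * u1 v + w2 v * u2 v + w3 v * u3 v) - (w1 v' * u1 v' + w2 v' * u2 v' + w3 v' * u3 v') = 0"
    unfolding deg2 by simp
  thus ?thesis unfolding lin(1-6)[THEN linear_form_add] by (simp add: algebra_simps)
qed

text \<open>At such a point \<open>w M u\<close> vanishes to second order, and the cubic is singular only at \<open>(1, 0, 0, 0)\<close>.\<close>

lemma common_zero_singular:
  assumes "u1 v = 0" "u2 v = 0" "u3 v = 0" "w1 v = 0" "w2 v = 0" "w3 v = 0"
  obtains x where "v = (x, 0, 0, 0)"
proof -
  obtain x y z t where v: "v = (x, y, z, t)" by (cases v)
  have lin_s: "p (x + s * x', y + s * y', z + s * z', t + s * t') =
      p (x, y, z, t) + s * p (x', y', z', t')" if "linear_form p" for p :: "'a point \<Rightarrow> 'a" and s x' y' z' t'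
    using that by (auto simp: linear_form_def algebra_simps)
  \<comment> \<open>On a line through \<open>v\<close> each \<open>w\<close> and each
    \<open>u\<close> contributes a factor \<open>s\<close>, so all directional derivatives of the
    cubic at \<open>v\<close> vanish.\<close>
  have dir: "\<exists>A B. \<forall>s. k * cubic (x + s * x', y + s * y', z + s * z', t + s * t') = s ^ 2 * (A + B * s)" for x' y' z' t'
  proof -
    let ?e = "(x', y', z', t')"
    let ?B = "\<lambda>v. w1 ?e * (m11 v * u1 ?e + m12 v * u2 ?e + m13 v * u3 ?e) +
      w2 ?e * (m21 v * u1 ?e + m22 v * u2 ?e + m23 v * u3 ?e) +
      w3 ?e * (m31 v * u1 ?e + m32 v * u2 ?e + m33 v * u3 ?e)"
    have "k * cubic (x + s * x', y + s * y', z + s * z', t + s * t') = s ^ 2 * (?B v + ?B ?e * s)" for s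
      unfolding deg3[symmetric] lin[THEN lin_s] using assms
      by (simp add: v algebra_simps power2_eq_square)
    thus ?thesis by blast
  qed
  \<comment> \<open>The derivative in the direction of \<open>x\<close> is
    \<open>y ^ 2\<close>.\<close>
  have "y = 0"
  proof -
    obtain A B where *: "k * cubic (x + s * 1, y + s * 0, z + s * 0, t + s * 0) = s ^ 2 * (A + B * s)" for s
      using dir by blast
    have "(k * (x * y ^ 2 + y * t ^ 2 + z ^ 3)) + (k * y ^ 2) * s + (- A) * s ^ 2 + (- B) * s ^ 3 + 0 * s ^ 4 = 0" for s
      using *[of s] by (simp add: algebra_simps power_numeral_reduce)
    from quartic_coeffs_zero(2)[OF this] k show ?thesis by simp
  qed
  moreover have "cubic v = 0" using cubic_zero assms by blast
  ultimately have yz: "y = 0" "z = 0" by (simp_all add: v)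
  \<comment> \<open>At \<open>y = z = 0\<close> the derivative in the direction of \<open>y\<close>
    is \<open>t ^ 2\<close>.\<close>
  obtain A B where *: "k * cubic (x + s * 0, y + s * 1, z + s * 0, t + s * 0) = s ^ 2 * (A + B * s)" for s
    using dir by blast
  have "0 + (k * t ^ 2) * s + (k * x - A) * s ^ 2 + (- B) * s ^ 3 + 0 * s ^ 4 = 0" for s
    using *[of s] yz by (simp add: algebra_simps power_numeral_reduce)
  from quartic_coeffs_zero(2)[OF this] k have "t = 0" by simp
  with that v yz show ?thesis by simp
qed

text \<open>At a common zero \<open>v\<close> of the column, \<open>polar\<close> makes the values
  of \<open>w\<close> at \<open>v\<close> a linear relation among the \<open>u\<close>. So they
  vanish, \<open>v\<close> is the singular point, and no \<open>u\<close> or \<open>w\<close>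
  involves \<open>x\<close>. Then \<open>deg2\<close> says that a product of two 3 x 3 coefficient
  matrices is skew-symmetric; a singular factor is again a relation among the \<open>u\<close> or
  the \<open>w\<close>.\<close>

lemma inconsistent: False
proof -
  obtain v where v: "v \<noteq> 0" "u1 v = 0" "u2 v = 0" "u3 v = 0"
    using linear_forms_common_zero[OF lin(4-6)] by blast
  have "w1 v * u1 v' + w2 v * u2 v' + w3 v * u3 v' = 0" for v'
    using polar[of v v'] v by (simp add: algebra_simps)
  hence "\<not> (w1 v \<noteq> 0 \<or> w2 v \<noteq> 0 \<or> w3 v \<noteq> 0)" using no_dependent_column by blast
  hence w: "w1 v = 0" "w2 v = 0" "w3 v = 0" by auto
  obtain x where x: "v = (x, 0, 0, 0)" using common_zero_singular[OF v(2-4) w] by blast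
  with v(1) have "x \<noteq> 0" by (auto simp: zero_prod_def)
  have free_x: "p (1,0,0,0) = 0" if "linear_form p" "p v = 0" for p
    using linear_form_expand[OF that(1), of x 0 0 0] that(2) x \<open>x \<noteq> 0\<close> by simp
  \<comment> \<open>By \<open>free_x\<close> the six forms are determined by their values at these
    three vectors.\<close>
  define E where "E j = ([(0,1,0,0), (0,0,1,0), (0,0,0,1)] ! j :: 'a point)" for j
  define W where "W = mat 3 3 (\<lambda>(i, j). ([w1, w2, w3] ! i) (E j))"
  define U where "U = mat 3 3 (\<lambda>(i, j). ([u1, u2, u3] ! i) (E j))"
  have W: "W \<in> carrier_mat 3 3" and U: "U \<in> carrier_mat 3 3" by (simp_all add: W_def U_def)
  have "transpose_mat (transpose_mat W * U) = - (transpose_mat W * U)"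
  proof (rule eq_matI)
    fix i j assume "i < dim_row (- (transpose_mat W * U))" "j < dim_col (- (transpose_mat W * U))"
    hence ij: "i < 3" "j < 3" using W U by auto
    have "(transpose_mat W * U) $$ (i, j) = w1 (E i) * u1 (E j) + w2 (E i) * u2 (E j) + w3 (E i) * u3 (E j)"
      if "i < 3" "j < 3" for i j
      using that by (simp add: W_def U_def scalar_prod_def sum_lessThan3)
    from this[OF ij] this[OF ij(2,1)] polar[of "E i" "E j"] ij W U
    show "transpose_mat (transpose_mat W * U) $$ (i, j) = (- (transpose_mat W * U)) $$ (i, j)"
      by (simp add: eq_neg_iff_add_eq_0 algebra_simps)
  qed (use W U in auto)
  hence "det W = 0 \<or> det U = 0" using singular_or_singular_of_skew W U by blast
  thus False
  proof
    assume "det U = 0"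
    then obtain a b c where abc: "a \<noteq> 0 \<or> b \<noteq> 0 \<or> c \<noteq> 0"
      "\<And>j. j < 3 \<Longrightarrow> a * U $$ (0, j) + b * U $$ (1, j) + c * U $$ (2, j) = 0"
      using left_kernel3[OF U] by blast
    let ?p = "\<lambda>v. a * u1 v + b * u2 v + c * u3 v"
    have lp: "linear_form ?p" by (intro linear_form_intros lin)
    have "?p (E j) = 0" if "j < 3" for j using abc(2)[OF that] that by (simp add: U_def)
    from this[of 0] this[of 1] this[of 2] have "?p v = 0" for v
      using linear_form_expand[OF lp, of "fst v" "fst (snd v)" "fst (snd (snd v))" "snd (snd (snd v))"]
        free_x[OF lin(4)] free_x[OF lin(5)] free_x[OF lin(6)] v
      by (simp add: E_def)
    thus False using no_dependent_column abc(1) by blast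
  next
    assume "det W = 0"
    then obtain a b c where abc: "a \<noteq> 0 \<or> b \<noteq> 0 \<or> c \<noteq> 0"
      "\<And>j. j < 3 \<Longrightarrow> a * W $$ (0, j) + b * W $$ (1, j) + c * W $$ (2, j) = 0"
      using left_kernel3[OF W] by blast
    let ?p = "\<lambda>v. a * w1 v + b * w2 v + c * w3 v"
    have lp: "linear_form ?p" by (intro linear_form_intros lin)
    have "?p (E j) = 0" if "j < 3" for j using abc(2)[OF that] that by (simp add: W_def)
    from this[of 0] this[of 1] this[of 2] have "?p v = 0" for v
      using linear_form_expand[OF lp, of "fst v" "fst (snd v)" "fst (snd (snd v))" "snd (snd (snd v))"]
        free_x[OF lin(1)] free_x[OF lin(2)] free_x[OF lin(3)] w
      by (simp add: E_def)
    thus False using bordered.no_dependent_column[OF transpose abc(1)] by blast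
  qed
qed

end

section \<open>Rank normal form and small determinants\<close>

definition diag_ones :: "nat \<Rightarrow> nat \<Rightarrow> 'a::field mat" where
  "diag_ones n r = mat n n (\<lambda>(i, j). if i = j \<and> i < r then 1 else 0)"

lemma diag_ones_full: "diag_ones n n = 1\<^sub>m n"
  by (intro eq_matI) (auto simp: diag_ones_def)

text \<open>Invertibility is stated through determinants because \<open>det P\<close> and
  \<open>det Q\<close> enter the later identities as scalar factors.\<close>

definition mat_equivalent :: "nat \<Rightarrow> 'a::field mat \<Rightarrow> 'a mat \<Rightarrow> bool" where
  "mat_equivalent n A C \<longleftrightarrow> (\<exists>P\<in>carrier_mat n n. \<exists>Q\<in>carrier_mat n n.
     det P \<noteq> 0 \<and> det Q \<noteq> 0 \<and> P * A * Q = C)"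

lemma mat_equivalentI:
  "P \<in> carrier_mat n n \<Longrightarrow> Q \<in> carrier_mat n n \<Longrightarrow> det P \<noteq> 0 \<Longrightarrow> det Q \<noteq> 0 \<Longrightarrow> P * A * Q = C \<Longrightarrow>
    mat_equivalent n A C"
  by (auto simp: mat_equivalent_def)

lemma mat_equivalent_trans:
  assumes "mat_equivalent n A B" "mat_equivalent n B C" and A: "A \<in> carrier_mat n n"
  shows "mat_equivalent n A C"
proof -
  obtain P Q P' Q' where *: "P \<in> carrier_mat n n" "Q \<in> carrier_mat n n"
    "P' \<in> carrier_mat n n" "Q' \<in> carrier_mat n n"
    "det P \<noteq> 0" "det Q \<noteq> 0" "det P' \<noteq> 0" "det Q' \<noteq> 0" "P * A * Q = B" "P' * B * Q' = C"
    using assms(1,2) by (auto simp: mat_equivalent_def)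
  show ?thesis
  proof (rule mat_equivalentI)
    show "P' * P * A * (Q * Q') = C"
    proof -
      have "P' * P * A * (Q * Q') = P' * (P * A) * (Q * Q')"
        using * A by (simp add: assoc_mult_mat[of _ n n _ n _ n])
      also have "\<dots> = P' * (P * A) * Q * Q'"
        using * A by (intro assoc_mult_mat[symmetric, of _ n n _ n _ n]) auto
      also have "P' * (P * A) * Q = P' * (P * A * Q)"
        using * A by (intro assoc_mult_mat[of _ n n _ n _ n]) auto
      finally show ?thesis using * by simp
    qed
  qed (use * in \<open>auto simp: det_mult[of _ n]\<close>)
qed

lemma row_swap_to_front:
  assumes "A \<in> carrier_mat n n" "i < n"
  obtains P where "P \<in> carrier_mat n n" "det P \<noteq> (0::'a::field)" "\<And>j. j < n \<Longrightarrow> (P * A) $$ (0, j) = A $$ (i, j)"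
proof (cases "i = 0")
  case True
  show ?thesis by (rule that[of "1\<^sub>m n"]) (use True assms in simp_all)
next
  case False
  have eq: "swaprows_mat n 0 i * A = swaprows 0 i A" using swaprows_mat[OF assms(1), of 0 i] assms(2) by simp
  show ?thesis
  proof (rule that[of "swaprows_mat n 0 i"])
    show "det (swaprows_mat n 0 i) \<noteq> (0::'a)"
      using det_swaprows_mat[of 0 n i, where 'a = 'a] False assms by simp
    show "(swaprows_mat n 0 i * A) $$ (0, j) = A $$ (i, j)" if "j < n" for j
      unfolding eq using that assms by auto
  qed simp
qed

text \<open>The column swap is obtained as a row swap of the transpose.\<close>

lemma mat_equivalent_nonzero_corner:
  assumes A: "A \<in> carrier_mat n n" and ij: "i < n" "j < n" "A $$ (i, j) \<noteq> 0"
  obtains C where "C \<in> carrier_mat n n" "C $$ (0, 0) \<noteq> 0" "mat_equivalent n A C"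
proof -
  obtain P where P: "P \<in> carrier_mat n n" "det P \<noteq> 0" "\<And>j. j < n \<Longrightarrow> (P * A) $$ (0, j) = A $$ (i, j)"
    using row_swap_to_front[OF A ij(1)] by blast
  let ?B = "transpose_mat (P * A)"
  have B: "?B \<in> carrier_mat n n" using P A by simp
  obtain Q where Q: "Q \<in> carrier_mat n n" "det Q \<noteq> 0" "\<And>i. i < n \<Longrightarrow> (Q * ?B) $$ (0, i) = ?B $$ (j, i)"
    using row_swap_to_front[OF B ij(2)] by blast
  have tr: "P * A * transpose_mat Q = transpose_mat (Q * ?B)"
    using P A Q by (simp add: transpose_mult[of _ n n _ n])
  show ?thesis
  proof (rule that)
    show "mat_equivalent n A (P * A * transpose_mat Q)"
      using P Q by (intro mat_equivalentI) (auto simp: det_transpose)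
    show "(P * A * transpose_mat Q) $$ (0, 0) \<noteq> 0"
      unfolding tr using Q P A ij by simp
  qed (use P A Q in simp)
qed

text \<open>Block elimination with the corner as pivot: \<open>e\<close> is its inverse,
  \<open>P\<close> normalises it and clears the column below, \<open>Q\<close> clears the row to the
  right, and \<open>?D\<close> is the Schur complement.\<close>

lemma mat_equivalent_split_corner:
  assumes A: "A \<in> carrier_mat (Suc n) (Suc n)" and ne: "A $$ (0, 0) \<noteq> 0"
  obtains D where "D \<in> carrier_mat n n"
    "mat_equivalent (Suc n) A (four_block_mat (1\<^sub>m 1) (0\<^sub>m 1 n) (0\<^sub>m n 1) D)"
proof -
  obtain a b c d where "split_block A 1 1 = (a, b, c, d)" by (cases "split_block A 1 1")
  from split_block[OF this, of n n] A
  have carr: "a \<in> carrier_mat 1 1" "b \<in> carrier_mat 1 n" "c \<in> carrier_mat n 1" "d \<in> carrier_mat n n"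
    and A_eq: "A = four_block_mat a b c d" by auto
  define e where "e = mat 1 1 (\<lambda>_. inverse (A $$ (0, 0)))"
  have e: "e \<in> carrier_mat 1 1" by (simp add: e_def)
  have "a $$ (0, 0) = A $$ (0, 0)" using carr by (simp add: A_eq)
  hence ea: "e * a = 1\<^sub>m 1" using carr ne by (intro eq_matI) (auto simp: e_def scalar_prod_def)
  have det_e: "det e \<noteq> 0" using ne by (simp add: det_single e_def)
  define P where "P = four_block_mat e (0\<^sub>m 1 n) (- (c * e)) (1\<^sub>m n)"
  define Q where "Q = four_block_mat (1\<^sub>m 1) (- (e * b)) (0\<^sub>m n 1) (1\<^sub>m n)"
  let ?D = "- (c * e) * b + d"
  have D: "?D \<in> carrier_mat n n" using carr e by simp
  have P: "P \<in> carrier_mat (Suc n) (Suc n)" and Q: "Q \<in> carrier_mat (Suc n) (Suc n)"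
    using carr e by (auto simp: P_def Q_def intro!: four_block_carrier_mat[of _ 1 1 _ n n, simplified])
  have "- (c * e) * a + c = 0\<^sub>m n 1"
  proof -
    have "- (c * e) * a = - (c * (e * a))"
      using carr e by (simp add: assoc_mult_mat[of c n 1 e 1 a 1])
    thus ?thesis using carr ea by simp
  qed
  hence "P * A = four_block_mat (1\<^sub>m 1) (e * b) (0\<^sub>m n 1) ?D"
    unfolding P_def A_eq using carr e ea
    by (subst mult_four_block_mat[of _ 1 1 _ n _ n _ _ 1 _ n]) auto
  hence "P * A * Q = four_block_mat (1\<^sub>m 1) (0\<^sub>m 1 n) (0\<^sub>m n 1) ?D"
    unfolding Q_def using carr e D
    by (simp, subst mult_four_block_mat[of _ 1 1 _ n _ n _ _ 1 _ n]) auto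
  moreover have "det P = det e" unfolding P_def using e carr
    by (subst det_four_block_mat_upper_right_zero[of _ 1 _ n]) auto
  moreover have "det Q = 1" unfolding Q_def using e carr
    by (subst det_four_block_mat_lower_left_zero[of _ 1 _ n]) auto
  ultimately show ?thesis
    using that[OF D] mat_equivalentI[OF P Q, of A] det_e by simp
qed

lemma mat_equivalent_four_block:
  assumes "mat_equivalent n D E" and D: "D \<in> carrier_mat n n"
  shows "mat_equivalent (Suc n) (four_block_mat (1\<^sub>m 1) (0\<^sub>m 1 n) (0\<^sub>m n 1) D)
    (four_block_mat (1\<^sub>m 1) (0\<^sub>m 1 n) (0\<^sub>m n 1) E)"
proof -
  obtain P Q where *: "P \<in> carrier_mat n n" "Q \<in> carrier_mat n n"
    "det P \<noteq> 0" "det Q \<noteq> 0" "P * D * Q = E"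
    using assms(1) by (auto simp: mat_equivalent_def)
  let ?e = "\<lambda>P :: 'a mat. four_block_mat (1\<^sub>m 1) (0\<^sub>m 1 n) (0\<^sub>m n 1) P"
  have carr: "?e P \<in> carrier_mat (Suc n) (Suc n)" if "P \<in> carrier_mat n n" for P
    using four_block_carrier_mat[OF one_carrier_mat[of 1] that] by simp
  have mult: "?e P * ?e Q = ?e (P * Q)" if "P \<in> carrier_mat n n" "Q \<in> carrier_mat n n" for P Q
    using that by (subst mult_four_block_mat[of _ 1 1 _ n _ n _ _ 1 _ n]) auto
  have det: "det (?e P) = det P" if "P \<in> carrier_mat n n" for P
    using that by (subst det_four_block_mat_lower_left_zero[of _ 1 _ n]) auto
  have "?e P * ?e D * ?e Q = ?e E"
    using * D mult[of P D] mult[of "P * D" Q] by (simp del: One_nat_def)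
  moreover have "det (?e P) \<noteq> 0" "det (?e Q) \<noteq> 0" using det *(1-4) by (simp_all del: One_nat_def)
  ultimately show ?thesis using carr *(1,2) by (intro mat_equivalentI[of "?e P" _ "?e Q"])
qed

text \<open>Gaussian elimination: a nonzero entry is moved to the corner and split off, and
  induction treats the Schur complement.\<close>

lemma mat_equivalent_diag_ones:
  assumes "A \<in> carrier_mat n n"
  shows "\<exists>r\<le>n. mat_equivalent n A (diag_ones n r)"
  using assms
proof (induction n arbitrary: A)
  case 0
  thus ?case by (intro exI[of _ 0]) (auto intro!: mat_equivalentI[of "1\<^sub>m 0" _ "1\<^sub>m 0"] simp: diag_ones_def)
next
  case (Suc n)
  show ?case
  proof (cases "A = 0\<^sub>m (Suc n) (Suc n)")
    case True
    have "diag_ones (Suc n) 0 = (0\<^sub>m (Suc n) (Suc n) :: 'a mat)"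
      by (intro eq_matI) (auto simp: diag_ones_def)
    thus ?thesis using True
      by (intro exI[of _ 0]) (auto intro!: mat_equivalentI[of "1\<^sub>m (Suc n)" _ "1\<^sub>m (Suc n)"])
  next
    case False
    have "\<exists>i<Suc n. \<exists>j<Suc n. A $$ (i, j) \<noteq> 0"
    proof (rule ccontr)
      assume "\<not> ?thesis"
      hence "A = 0\<^sub>m (Suc n) (Suc n)" using Suc.prems by (intro eq_matI) auto
      with False show False by simp
    qed
    then obtain i j where "i < Suc n" "j < Suc n" "A $$ (i, j) \<noteq> 0" by blast
    from mat_equivalent_nonzero_corner[OF Suc.prems this] obtain C where
      C: "C \<in> carrier_mat (Suc n) (Suc n)" "C $$ (0, 0) \<noteq> 0" "mat_equivalent (Suc n) A C" .
    from mat_equivalent_split_corner[OF C(1,2)] obtain D where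
      D: "D \<in> carrier_mat n n"
      "mat_equivalent (Suc n) C (four_block_mat (1\<^sub>m 1) (0\<^sub>m 1 n) (0\<^sub>m n 1) D)" .
    from Suc.IH[OF D(1)] obtain r where r: "r \<le> n" "mat_equivalent n D (diag_ones n r)" by auto
    have "four_block_mat (1\<^sub>m 1) (0\<^sub>m 1 n) (0\<^sub>m n 1) (diag_ones n r) = (diag_ones (Suc n) (Suc r) :: 'a mat)"
      by (intro eq_matI) (auto simp: diag_ones_def)
    hence "mat_equivalent (Suc n) A (diag_ones (Suc n) (Suc r))"
      using mat_equivalent_trans[OF mat_equivalent_trans[OF C(3) D(2)]
          mat_equivalent_four_block[OF r(2) D(1)]] Suc.prems by simp
    thus ?thesis using r(1) by (intro exI[of _ "Suc r"]) simp
  qed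
qed

section \<open>Explicit minors and determinants up to size four\<close>

definition minor2 :: "'a::comm_ring_1 mat \<Rightarrow> nat \<Rightarrow> nat \<Rightarrow> nat \<Rightarrow> nat \<Rightarrow> 'a" where
  "minor2 A i j p q = A $$ (i, p) * A $$ (j, q) - A $$ (i, q) * A $$ (j, p)"

definition minor3 ::
    "'a::comm_ring_1 mat \<Rightarrow> nat \<Rightarrow> nat \<Rightarrow> nat \<Rightarrow> nat \<Rightarrow> nat \<Rightarrow> nat \<Rightarrow> 'a" where
  "minor3 A i j k p q r =
     A $$ (i, p) * minor2 A j k q r - A $$ (i, q) * minor2 A j k p r + A $$ (i, r) * minor2 A j k p q"

lemma det_2:
  assumes A: "A \<in> carrier_mat 2 2"
  shows "det A = minor2 A 0 1 0 1"
  using A by (subst laplace_expansion_row[OF A, of 0])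
    (auto simp: minor2_def cofactor_def mat_delete_def det_single lessThan_Suc numeral_2_eq_2)

lemma det_3:
  assumes A: "A \<in> carrier_mat 3 3"
  shows "det A = minor3 A 0 1 2 0 1 2"
proof -
  have "det A = (\<Sum>j=0..<3. A $$ (0,j) * cofactor A 0 j)"
    using laplace_expansion_row[OF A, of 0] by (simp add: atLeast0LessThan)
  thus ?thesis using A
    by (simp add: sum_lessThan3 cofactor_def mat_delete_def det_2 minor2_def minor3_def
        numeral_2_eq_2 algebra_simps)
qed

lemma det_4:
  assumes A: "A \<in> carrier_mat 4 4"
  shows "det A = A $$ (0,0) * minor3 A 1 2 3 1 2 3 - A $$ (0,1) * minor3 A 1 2 3 0 2 3
    + A $$ (0,2) * minor3 A 1 2 3 0 1 3 - A $$ (0,3) * minor3 A 1 2 3 0 1 2"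
proof -
  have "det A = (\<Sum>j=0..<4. A $$ (0,j) * cofactor A 0 j)"
    using laplace_expansion_row[OF A, of 0] by (simp add: atLeast0LessThan)
  thus ?thesis using A
    by (simp add: sum_lessThan4 cofactor_def mat_delete_def det_3 minor2_def minor3_def
        eval_nat_numeral algebra_simps)
qed

text \<open>The coefficient of \<open>s ^ j\<close> is the sum of the principal minors of
  \<open>N\<close> of size \<open>j\<close> whose index set contains every index from
  \<open>r\<close> on; the other indices use the ones on the diagonal.\<close>

lemma det_diag_ones_plus:
  fixes N :: "'a::field mat"
  assumes N: "N \<in> carrier_mat 4 4"
  shows "det (diag_ones 4 0 + s \<cdot>\<^sub>m N) = det N * s ^ 4"
    "det (diag_ones 4 1 + s \<cdot>\<^sub>m N) = minor3 N 1 2 3 1 2 3 * s ^ 3 + det N * s ^ 4"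
    "det (diag_ones 4 2 + s \<cdot>\<^sub>m N) = minor2 N 2 3 2 3 * s ^ 2 +
       (minor3 N 0 2 3 0 2 3 + minor3 N 1 2 3 1 2 3) * s ^ 3 + det N * s ^ 4"
    "det (diag_ones 4 3 + s \<cdot>\<^sub>m N) = N $$ (3,3) * s +
       (minor2 N 0 3 0 3 + minor2 N 1 3 1 3 + minor2 N 2 3 2 3) * s ^ 2 +
       (minor3 N 0 1 3 0 1 3 + minor3 N 0 2 3 0 2 3 + minor3 N 1 2 3 1 2 3) * s ^ 3 + det N * s ^ 4"
proof -
  have carr: "diag_ones 4 r + s \<cdot>\<^sub>m N \<in> carrier_mat 4 4" for r
    using N by (simp add: diag_ones_def)
  have entry: "(diag_ones 4 r + s \<cdot>\<^sub>m N) $$ (i, j) = (if i = j \<and> i < r then 1 else 0) + s * N $$ (i, j)"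
    if "i < 4" "j < 4" for i j r
    using that N by (simp add: diag_ones_def)
  note simps = det_4[OF carr] det_4[OF N] minor3_def minor2_def entry
  show "det (diag_ones 4 0 + s \<cdot>\<^sub>m N) = det N * s ^ 4"
    by (simp add: simps algebra_simps power_numeral_reduce)
  show "det (diag_ones 4 1 + s \<cdot>\<^sub>m N) = minor3 N 1 2 3 1 2 3 * s ^ 3 + det N * s ^ 4"
    by (simp add: simps algebra_simps power_numeral_reduce)
  show "det (diag_ones 4 2 + s \<cdot>\<^sub>m N) = minor2 N 2 3 2 3 * s ^ 2 +
       (minor3 N 0 2 3 0 2 3 + minor3 N 1 2 3 1 2 3) * s ^ 3 + det N * s ^ 4"
    by (simp add: simps algebra_simps power_numeral_reduce)
  show "det (diag_ones 4 3 + s \<cdot>\<^sub>m N) = N $$ (3,3) * s +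
       (minor2 N 0 3 0 3 + minor2 N 1 3 1 3 + minor2 N 2 3 2 3) * s ^ 2 +
       (minor3 N 0 1 3 0 1 3 + minor3 N 0 2 3 0 2 3 + minor3 N 1 2 3 1 2 3) * s ^ 3 + det N * s ^ 4"
    by (simp add: simps algebra_simps power_numeral_reduce)
qed

section \<open>Determinants of matrices of linear forms\<close>

definition linear_mat :: "nat \<Rightarrow> ('a::field point \<Rightarrow> 'a mat) \<Rightarrow> bool" where
  "linear_mat n N \<longleftrightarrow> (\<forall>v. N v \<in> carrier_mat n n) \<and>
     (\<forall>i<n. \<forall>j<n. linear_form (\<lambda>v. N v $$ (i, j)))"

lemma linear_mat_carrier: "linear_mat n N \<Longrightarrow> N v \<in> carrier_mat n n"
  unfolding linear_mat_def by blast

lemma linear_mat_entry: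
  "linear_mat n N \<Longrightarrow> i < n \<Longrightarrow> j < n \<Longrightarrow> linear_form (\<lambda>v. N v $$ (i, j))"
  unfolding linear_mat_def by blast

lemma linear_form_sum:
  "finite I \<Longrightarrow> (\<And>i. i \<in> I \<Longrightarrow> linear_form (p i)) \<Longrightarrow> linear_form (\<lambda>v. \<Sum>i\<in>I. p i v)"
proof (induction I rule: finite_induct)
  case empty
  show ?case unfolding linear_form_def by (rule exI[of _ 0])+ simp
qed (auto intro!: linear_form_plus)

lemma linear_mat_mult:
  assumes N: "linear_mat n N" and P: "P \<in> carrier_mat n n" and Q: "Q \<in> carrier_mat n n"
  shows "linear_mat n (\<lambda>v. P * N v * Q)"
proof -
  note carr = linear_mat_carrier[OF N]
  have lin: "linear_form (\<lambda>v. N v $$ (i, j))" if "i < n" "j < n" for i j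
    using linear_mat_entry[OF N that] .
  have entry: "(P * N v * Q) $$ (i, j) = (\<Sum>a = 0..<n. P $$ (i, a) * (\<Sum>b = 0..<n. Q $$ (b, j) * N v $$ (a, b)))"
    if "i < n" "j < n" for i j v
    using that carr[of v] P Q by (simp add: scalar_prod_def mult.commute)
  show ?thesis unfolding linear_mat_def
  proof (intro conjI allI impI)
    show "P * N v * Q \<in> carrier_mat n n" for v using P Q carr[of v] by simp
    fix i j assume ij: "i < n" "j < n"
    show "linear_form (\<lambda>v. (P * N v * Q) $$ (i, j))"
      unfolding entry[OF ij] using lin by (intro linear_form_sum linear_form_scale) auto
  qed
qed

lemma linear_mat_scale_point:
  assumes N: "linear_mat n N"
  shows "N (s * x, s * y, s * z, s * t) = s \<cdot>\<^sub>m N (x, y, z, t)"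
proof (rule eq_matI)
  note carr = linear_mat_carrier[OF N]
  show "dim_row (N (s * x, s * y, s * z, s * t)) = dim_row (s \<cdot>\<^sub>m N (x, y, z, t))"
    "dim_col (N (s * x, s * y, s * z, s * t)) = dim_col (s \<cdot>\<^sub>m N (x, y, z, t))"
    using carr[of "(s * x, s * y, s * z, s * t)"] carr[of "(x, y, z, t)"] by auto
  fix i j assume "i < dim_row (s \<cdot>\<^sub>m N (x, y, z, t))" "j < dim_col (s \<cdot>\<^sub>m N (x, y, z, t))"
  hence ij: "i < n" "j < n" using carr[of "(x, y, z, t)"] by auto
  hence "linear_form (\<lambda>v. N v $$ (i, j))" using linear_mat_entry[OF N] by blast
  thus "N (s * x, s * y, s * z, s * t) $$ (i, j) = (s \<cdot>\<^sub>m N (x, y, z, t)) $$ (i, j)"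
    using ij carr[of "(x, y, z, t)"] by (auto simp: linear_form_def algebra_simps)
qed

section \<open>Linear determinants of size three\<close>

lemma linear_factor_of_cube:
  assumes "linear_form p" "k \<noteq> 0" "\<And>z t. p (0, 0, z, t) * r z t = k * z ^ 3"
  shows "p (0,0,0,1) = 0"
proof (rule ccontr)
  assume *: "p (0,0,0,1) \<noteq> 0"
  \<comment> \<open>A zero of \<open>p\<close> with \<open>z = 1\<close>, where the right side is
    \<open>k\<close>.\<close>
  have "p (0, 0, 1, - p (0,0,1,0) / p (0,0,0,1)) = 0"
    using linear_form_expand[OF assms(1), of 0 0 1 "- p (0,0,1,0) / p (0,0,0,1)"] * by simp
  with assms(3)[of 1 "- p (0,0,1,0) / p (0,0,0,1)"] assms(2) show False by simp
qed

text \<open>The matrix has rows \<open>(g, w1, w2)\<close>, \<open>(u1, a, b)\<close>,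
  \<open>(u2, c, d)\<close>. As the block columns are proportional on \<open>y = 0\<close>, one
  column and one row operation make the block triangular with diagonal \<open>k * y\<close>,
  \<open>de * y\<close>. The new entries \<open>w\<close> and \<open>u\<close> contain no
  \<open>t\<close>, so the determinant misses \<open>y * t ^ 2\<close>.\<close>

lemma no_det_square_block_aux:
  fixes g w1 w2 u1 u2 a b c d :: "'a::field_char_0 point \<Rightarrow> 'a"
  assumes lin: "linear_form g" "linear_form w1" "linear_form w2" "linear_form u1" "linear_form u2"
      "linear_form a" "linear_form b" "linear_form c" "linear_form d"
    and k: "k \<noteq> 0"
    and block: "\<And>x y z t. a (x, y, z, t) * d (x, y, z, t) - b (x, y, z, t) * c (x, y, z, t) = k * y ^ 2"
    and det: "\<And>v. g v * (a v * d v - b v * c v) - w1 v * (u1 v * d v - u2 v * b v) +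
      w2 v * (u1 v * c v - u2 v * a v) = k * cubic v"
    and rel: "\<And>x z t. b (x, 0, z, t) = l * a (x, 0, z, t)" "\<And>x z t. d (x, 0, z, t) = l * c (x, 0, z, t)"
    and de: "d (0,1,0,0) - l * c (0,1,0,0) \<noteq> 0"
  shows False
proof -
  define be where "be = b (0,1,0,0) - l * a (0,1,0,0)"
  define de where "de = d (0,1,0,0) - l * c (0,1,0,0)"
  have de0: "de \<noteq> 0" using assms by (simp add: de_def)
  have split_y: "p (x, y, z, t) = p (0,1,0,0) * y + p (x, 0, z, t)" if "linear_form p" for p :: "'a point \<Rightarrow> 'a" and x y z t
    using linear_form_expand[OF that, of x y z t] linear_form_expand[OF that, of x 0 z t] by simp
  have b: "b (x, y, z, t) = l * a (x, y, z, t) + be * y" for x y z t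
    using split_y[OF lin(7), of x y z t] split_y[OF lin(6), of x y z t] rel
    by (simp add: be_def algebra_simps)
  have d: "d (x, y, z, t) = l * c (x, y, z, t) + de * y" for x y z t
    using split_y[OF lin(9), of x y z t] split_y[OF lin(8), of x y z t] rel
    by (simp add: de_def algebra_simps)
  let ?y = "(\<lambda>(x, y, z, t). y) :: 'a point \<Rightarrow> 'a"
  \<comment> \<open>\<open>block\<close> says that \<open>y\<close> times this form is zero.\<close>
  let ?p = "\<lambda>v. de * a v - be * c v - k * ?y v"
  have prod0: "?y v * ?p v = 0" for v
  proof (cases v)
    case (fields x y z t)
    show ?thesis using block[of x y z t] unfolding fields b d
      by (simp add: algebra_simps power2_eq_square)
  qed
  have "linear_form ?p"
    by (rule linear_form_minus[OF linear_form_minus[OF linear_form_scale[OF lin(6)] linear_form_scale[OF lin(8)]]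
          linear_form_scale[OF linear_form_coord(2)]])
  from linear_forms_prod_zero[OF linear_form_coord(2) this prod0]
  have p0: "\<forall>v. ?p v = 0"
  proof
    assume "\<forall>v. ?y v = 0"
    from spec[OF this, of "(0,1,0,0)"] show ?thesis by simp
  qed
  have ky: "de * a (x, y, z, t) = be * c (x, y, z, t) + k * y" for x y z t
    using spec[OF p0, of "(x, y, z, t)"] by (simp add: algebra_simps)
  \<comment> \<open>\<open>w\<close> comes from the third column minus \<open>l\<close> times the
    second, \<open>u\<close> from \<open>de\<close> times the second row minus \<open>be\<close>
    times the third.\<close>
  define w where "w v = w2 v - l * w1 v" for v
  define u where "u v = de * u1 v - be * u2 v" for v
  have lwu: "linear_form w" "linear_form u"
    unfolding w_def u_def by (intro linear_form_intros lin)+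
  have key: "de * k * cubic (x, y, z, t) = de * k * g (x, y, z, t) * y ^ 2 -
     de * w1 (x, y, z, t) * u (x, y, z, t) * y +
     w (x, y, z, t) * (u (x, y, z, t) * c (x, y, z, t) - k * y * u2 (x, y, z, t))" for x y z t
  proof -
    let ?v = "(x, y, z, t)"
    have 1: "de * (u1 ?v * c ?v - u2 ?v * a ?v) = u ?v * c ?v - k * y * u2 ?v"
    proof -
      have "de * (u1 ?v * c ?v - u2 ?v * a ?v) = de * u1 ?v * c ?v - u2 ?v * (de * a ?v)"
        by (simp add: algebra_simps)
      thus ?thesis unfolding ky u_def by (simp add: algebra_simps)
    qed
    have 2: "u1 ?v * d ?v - u2 ?v * b ?v = l * (u1 ?v * c ?v - u2 ?v * a ?v) + u ?v * y"
      unfolding b d u_def by (simp add: algebra_simps)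
    have 3: "k * cubic ?v = g ?v * (k * y ^ 2) - w1 ?v * u ?v * y + w ?v * (u1 ?v * c ?v - u2 ?v * a ?v)"
      unfolding det[symmetric] block 2 w_def by (simp add: algebra_simps)
    have "de * k * cubic ?v = de * (g ?v * (k * y ^ 2) - w1 ?v * u ?v * y + w ?v * (u1 ?v * c ?v - u2 ?v * a ?v))"
      unfolding 3[symmetric] by (simp only: mult.assoc)
    also have "\<dots> = de * k * g ?v * y ^ 2 - de * w1 ?v * u ?v * y +
        w ?v * (de * (u1 ?v * c ?v - u2 ?v * a ?v))"
      by (simp add: algebra_simps)
    finally show ?thesis unfolding 1 .
  qed
  have prod: "w (0, 0, z, t) * (u (0, 0, z, t) * c (0, 0, z, t)) = (de * k) * z ^ 3"
    "u (0, 0, z, t) * (w (0, 0, z, t) * c (0, 0, z, t)) = (de * k) * z ^ 3" for z t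
    using key[of 0 0 z t] by (simp_all add: algebra_simps)
  have w0: "w (0,0,0,1) = 0"
    by (rule linear_factor_of_cube[OF lwu(1) _ prod(1)]) (use de0 k in simp)
  have u0: "u (0,0,0,1) = 0"
    by (rule linear_factor_of_cube[OF lwu(2) _ prod(2)]) (use de0 k in simp)
  have ex: "p (0, s, 0, 1) = p (0,1,0,0) * s + p (0,0,0,1)"
    if "linear_form p" for p :: "'a point \<Rightarrow> 'a" and s
    using linear_form_expand[OF that, of 0 s 0 1] by simp
  let ?e = "(0,1,0,0) :: 'a point" and ?t = "(0,0,0,1) :: 'a point"
  \<comment> \<open>On \<open>(0, s, 0, 1)\<close> both \<open>w\<close> and \<open>u\<close> are
    multiples of \<open>s\<close>, so the right side of \<open>key\<close> is divisible by
    \<open>s ^ 2\<close> while the left side is \<open>de * k * s\<close>.\<close>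
  have "0 + (de * k) * s +
     (- de * k * g ?t + de * w1 ?t * u ?e - w ?e * (u ?e * c ?t - k * u2 ?t)) * s ^ 2 +
     (- de * k * g ?e + de * w1 ?e * u ?e - w ?e * (u ?e * c ?e - k * u2 ?e)) * s ^ 3 + 0 * s ^ 4 = 0" for s
    using key[of 0 s 0 1]
    by (simp add: ex[OF lwu(1), of s] ex[OF lwu(2), of s] w0 u0 ex[OF lin(1), of s] ex[OF lin(2), of s]
       ex[OF lin(5), of s] ex[OF lin(8), of s] algebra_simps power2_eq_square power3_eq_cube)
  from quartic_coeffs_zero(2)[OF this] de0 k show False by simp
qed

text \<open>If \<open>d - l * c\<close> has no \<open>y\<close>-term, then \<open>b - l * a\<close>
  has one, for otherwise \<open>block\<close> fails at \<open>(0,1,0,0)\<close>. Swapping the last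
  two rows, with \<open>- k\<close> for \<open>k\<close>, exchanges these two.\<close>

lemma no_det_square_block_col:
  fixes g w1 w2 u1 u2 a b c d :: "'a::field_char_0 point \<Rightarrow> 'a"
  assumes lin: "linear_form g" "linear_form w1" "linear_form w2" "linear_form u1" "linear_form u2"
      "linear_form a" "linear_form b" "linear_form c" "linear_form d"
    and k: "k \<noteq> 0"
    and block: "\<And>x y z t. a (x, y, z, t) * d (x, y, z, t) - b (x, y, z, t) * c (x, y, z, t) = k * y ^ 2"
    and det: "\<And>v. g v * (a v * d v - b v * c v) - w1 v * (u1 v * d v - u2 v * b v) +
      w2 v * (u1 v * c v - u2 v * a v) = k * cubic v"
    and rel: "\<And>x z t. b (x, 0, z, t) = l * a (x, 0, z, t)" "\<And>x z t. d (x, 0, z, t) = l * c (x, 0, z, t)"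
  shows False
proof (cases "d (0,1,0,0) - l * c (0,1,0,0) = 0")
  case False
  show False by (rule no_det_square_block_aux[OF lin k block det rel False])
next
  case True
  have "b (0,1,0,0) - l * a (0,1,0,0) \<noteq> 0"
  proof
    assume "b (0,1,0,0) - l * a (0,1,0,0) = 0"
    thus False using block[of 0 1 0 0] True k by (simp add: algebra_simps)
  qed
  moreover have "c (x, y, z, t) * b (x, y, z, t) - d (x, y, z, t) * a (x, y, z, t) = - k * y ^ 2" for x y z t
    using block[of x y z t] by (simp add: algebra_simps)
  moreover have "g v * (c v * b v - d v * a v) - w1 v * (u2 v * b v - u1 v * d v) +
      w2 v * (u2 v * a v - u1 v * c v) = - k * cubic v" for v
    using det[of v] by (simp add: algebra_simps)
  ultimately show False
    using no_det_square_block_aux[of g w1 w2 u2 u1 c d a b "- k" l] lin k rel by simp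
qed

text \<open>On \<open>y = 0\<close> the block is singular, so its columns or its rows are
  proportional there. The four cases differ by transposing and by a swap that changes the sign of
  \<open>k\<close>.\<close>

lemma no_det_square_block:
  fixes g w1 w2 u1 u2 a b c d :: "'a::field_char_0 point \<Rightarrow> 'a"
  assumes lin: "linear_form g" "linear_form w1" "linear_form w2" "linear_form u1" "linear_form u2"
      "linear_form a" "linear_form b" "linear_form c" "linear_form d"
    and k: "k \<noteq> 0"
    and block: "\<And>x y z t. a (x, y, z, t) * d (x, y, z, t) - b (x, y, z, t) * c (x, y, z, t) = k * y ^ 2"
    and det: "\<And>v. g v * (a v * d v - b v * c v) - w1 v * (u1 v * d v - u2 v * b v) +
      w2 v * (u1 v * c v - u2 v * a v) = k * cubic v"
  shows False
proof -
  define res where "res p = ((\<lambda>(x, y, z, t). p (x, 0, z, t)) :: 'a point \<Rightarrow> 'a)" for p :: "'a point \<Rightarrow> 'a"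
  have res: "linear_form (res p)" if "linear_form p" for p
  proof -
    have "res p (x, y, z, t) = p (1,0,0,0) * x + 0 * y + p (0,0,1,0) * z + p (0,0,0,1) * t" for x y z t
      using linear_form_expand[OF that, of x 0 z t] by (simp add: res_def)
    thus ?thesis unfolding linear_form_def by blast
  qed
  have "res a v * res d v = res b v * res c v" for v
  proof (cases v)
    case (fields x y z t)
    show ?thesis using block[of x 0 z t] by (simp add: res_def fields)
  qed
  from linear_forms_det_zero[OF lin(6-9)[THEN res] this] obtain l where
    "(\<forall>v. res b v = l * res a v \<and> res d v = l * res c v) \<or>
     (\<forall>v. res a v = l * res b v \<and> res c v = l * res d v) \<or>
     (\<forall>v. res c v = l * res a v \<and> res d v = l * res b v) \<or>
     (\<forall>v. res a v = l * res c v \<and> res b v = l * res d v)" .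
  then consider "\<forall>v. res b v = l * res a v \<and> res d v = l * res c v"
    | "\<forall>v. res a v = l * res b v \<and> res c v = l * res d v"
    | "\<forall>v. res c v = l * res a v \<and> res d v = l * res b v"
    | "\<forall>v. res a v = l * res c v \<and> res b v = l * res d v" by blast
  thus False
  proof cases
    case 1
    hence "b (x, 0, z, t) = l * a (x, 0, z, t)" "d (x, 0, z, t) = l * c (x, 0, z, t)" for x z t
      by (auto simp: res_def)
    thus False by (rule no_det_square_block_col[OF lin k block det])
  next
    case 2
    hence "a (x, 0, z, t) = l * b (x, 0, z, t)" "c (x, 0, z, t) = l * d (x, 0, z, t)" for x z t
      by (auto simp: res_def)
    moreover have "b (x, y, z, t) * c (x, y, z, t) - a (x, y, z, t) * d (x, y, z, t) = - k * y ^ 2" for x y z t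
      using block[of x y z t] by (simp add: algebra_simps)
    moreover have "g v * (b v * c v - a v * d v) - w2 v * (u1 v * c v - u2 v * a v) +
        w1 v * (u1 v * d v - u2 v * b v) = - k * cubic v" for v
      using det[of v] by (simp add: algebra_simps)
    ultimately show False
      using no_det_square_block_col[of g w2 w1 u1 u2 b a d c "- k" l] lin k by simp
  next
    case 3
    hence "c (x, 0, z, t) = l * a (x, 0, z, t)" "d (x, 0, z, t) = l * b (x, 0, z, t)" for x z t
      by (auto simp: res_def)
    moreover have "a (x, y, z, t) * d (x, y, z, t) - c (x, y, z, t) * b (x, y, z, t) = k * y ^ 2" for x y z t
      using block[of x y z t] by (simp add: algebra_simps)
    moreover have "g v * (a v * d v - c v * b v) - u1 v * (w1 v * d v - w2 v * c v) +
        u2 v * (w1 v * b v - w2 v * a v) = k * cubic v" for v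
      using det[of v] by (simp add: algebra_simps)
    ultimately show False
      using no_det_square_block_col[of g u1 u2 w1 w2 a c b d k l] lin k by simp
  next
    case 4
    hence "a (x, 0, z, t) = l * c (x, 0, z, t)" "b (x, 0, z, t) = l * d (x, 0, z, t)" for x z t
      by (auto simp: res_def)
    moreover have "c (x, y, z, t) * b (x, y, z, t) - a (x, y, z, t) * d (x, y, z, t) = - k * y ^ 2" for x y z t
      using block[of x y z t] by (simp add: algebra_simps)
    moreover have "g v * (c v * b v - a v * d v) - u2 v * (w1 v * b v - w2 v * a v) +
        u1 v * (w1 v * d v - w2 v * c v) = - k * cubic v" for v
      using det[of v] by (simp add: algebra_simps)
    ultimately show False
      using no_det_square_block_col[of g u2 u1 w1 w2 c a d b "- k" l] lin k by simp
  qed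
qed


text \<open>Normalising the value at the singular point \<open>(1,0,0,0)\<close> leaves
  \<open>x\<close> only in the first \<open>r\<close> diagonal entries. For \<open>r = 0\<close> the
  determinant would be independent of \<open>x\<close>, for \<open>r = 3\<close> it would contain
  \<open>x ^ 3\<close>. For \<open>r = 2\<close> the missing \<open>x ^ 2\<close> kills an entry,
  and for \<open>r = 1\<close> the coefficient of \<open>x\<close> gives a 2 x 2 block of
  determinant \<open>k' * y ^ 2\<close>.\<close>

lemma no_linear_det3:
  fixes G :: "'a::field_char_0 point \<Rightarrow> 'a mat"
  assumes G: "linear_mat 3 G" and k: "k \<noteq> 0" and det: "\<And>v. det (G v) = k * cubic v"
  shows False
proof -
  obtain r P Q where r: "r \<le> 3" and PQ: "P \<in> carrier_mat 3 3" "Q \<in> carrier_mat 3 3"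
    "det P \<noteq> 0" "det Q \<noteq> 0" "P * G (1,0,0,0) * Q = diag_ones 3 r"
    using mat_equivalent_diag_ones[OF linear_mat_carrier[OF G], of "(1,0,0,0)"]
    unfolding mat_equivalent_def by blast
  define H where "H v = P * G v * Q" for v
  have H: "linear_mat 3 H" unfolding H_def by (rule linear_mat_mult[OF G PQ(1,2)])
  define k' where "k' = det P * k * det Q"
  have k': "k' \<noteq> 0" using k PQ by (simp add: k'_def)
  have det_H: "det (H v) = k' * cubic v" for v
    using PQ linear_mat_carrier[OF G] by (simp add: H_def k'_def det_mult[of _ 3] det)
  define h where "h i j v = H v $$ (i, j)" for i j v
  have lin: "linear_form (h i j)" if "i < 3" "j < 3" for i j
    unfolding h_def using linear_mat_entry[OF H that] .
  have det': "minor3 (H v) 0 1 2 0 1 2 = k' * cubic v" for v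
    using det_3[OF linear_mat_carrier[OF H]] det_H by simp
  have hx: "h i j (x, y, z, t) = (if i = j \<and> i < r then x else 0) + h i j (0, y, z, t)"
    if "i < 3" "j < 3" for i j x y z t
  proof -
    have "h i j (1,0,0,0) = (if i = j \<and> i < r then 1 else 0)"
      using PQ(5) that by (simp add: h_def H_def diag_ones_def)
    thus ?thesis using linear_form_expand[OF lin[OF that], of x y z t]
      linear_form_expand[OF lin[OF that], of 0 y z t] by simp
  qed
  have n3: "0 < (3::nat)" "1 < (3::nat)" "2 < (3::nat)" by simp_all
  have det_h: "h 0 0 v * (h 1 1 v * h 2 2 v - h 1 2 v * h 2 1 v) -
      h 0 1 v * (h 1 0 v * h 2 2 v - h 2 0 v * h 1 2 v) +
      h 0 2 v * (h 1 0 v * h 2 1 v - h 2 0 v * h 1 1 v) = k' * cubic v" for v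
    using det'[of v] by (simp add: minor3_def minor2_def h_def algebra_simps)
  consider "r = 0" | "r = 1" | "r = 2" | "r = 3" using r by linarith
  thus False
  proof cases
    case 1
    have "h i j (1,1,0,0) = h i j (0,1,0,0)" if "i < 3" "j < 3" for i j
      using hx[OF that, of 1 1 0 0] 1 by simp
    hence "k' * cubic (1,1,0,0) = k' * cubic (0,1,0,0)"
      unfolding det_h[symmetric] by simp
    thus False using k' by simp
  next
    case 4
    have "det (H (1,0,0,0)) = 1"
      using PQ(5) 4 by (simp add: H_def diag_ones_full)
    thus False using det_H[of "(1,0,0,0)"] by simp
  next
    case 3
    have h22: "h 2 2 (x, y, z, t) = 0" for x y z t
    proof -
      let ?h = "\<lambda>i j. h i j (0, y, z, t)"
      have "(?h 0 0 * (?h 1 1 * ?h 2 2 - ?h 1 2 * ?h 2 1) - ?h 0 1 * (?h 1 0 * ?h 2 2 - ?h 2 0 * ?h 1 2) +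
            ?h 0 2 * (?h 1 0 * ?h 2 1 - ?h 2 0 * ?h 1 1) - k' * (y * t ^ 2 + z ^ 3)) +
          (?h 0 0 * ?h 2 2 + ?h 1 1 * ?h 2 2 - ?h 1 2 * ?h 2 1 - ?h 0 2 * ?h 2 0 - k' * y ^ 2) * s +
          ?h 2 2 * s ^ 2 + 0 * s ^ 3 + 0 * s ^ 4 = 0" for s
        using det_h[of "(s, y, z, t)"]
        unfolding hx[OF n3(1) n3(1), of s y z t] hx[OF n3(1) n3(2), of s y z t] hx[OF n3(1) n3(3), of s y z t]
          hx[OF n3(2) n3(1), of s y z t] hx[OF n3(2) n3(2), of s y z t] hx[OF n3(2) n3(3), of s y z t]
          hx[OF n3(3) n3(1), of s y z t] hx[OF n3(3) n3(2), of s y z t] hx[OF n3(3) n3(3), of s y z t]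
        using 3 by (simp add: algebra_simps power2_eq_square)
      from quartic_coeffs_zero(3)[OF this] hx[of 2 2 x y z t] 3 show ?thesis by simp
    qed
    \<comment> \<open>With a zero corner, every term contains an entry of the last row and one of
      the last column.\<close>
    have "k' * cubic v = h 2 0 v * (h 0 2 v * (- h 1 1 v) + h 1 2 v * h 0 1 v) +
        h 2 1 v * (h 0 2 v * h 1 0 v + h 1 2 v * (- h 0 0 v))" for v
      using det_h[of v] h22 by (cases v) (simp add: algebra_simps)
    from cubic_not_in_line_ideal_squared[OF lin lin lin lin linear_form_uminus[OF lin] lin lin
        linear_form_uminus[OF lin] k' this]
    show False by simp
  next
    case 2
    show False
    proof (rule no_det_square_block[OF _ _ _ _ _ _ _ _ _ k' _ det_h])
      fix x y z t
      let ?h = "\<lambda>i j. h i j (0, y, z, t)"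
      have "(?h 0 0 * (?h 1 1 * ?h 2 2 - ?h 1 2 * ?h 2 1) - ?h 0 1 * (?h 1 0 * ?h 2 2 - ?h 2 0 * ?h 1 2) +
            ?h 0 2 * (?h 1 0 * ?h 2 1 - ?h 2 0 * ?h 1 1) - k' * (y * t ^ 2 + z ^ 3)) +
          (?h 1 1 * ?h 2 2 - ?h 1 2 * ?h 2 1 - k' * y ^ 2) * s +
          0 * s ^ 2 + 0 * s ^ 3 + 0 * s ^ 4 = 0" for s
        using det_h[of "(s, y, z, t)"]
        unfolding hx[OF n3(1) n3(1), of s y z t] hx[OF n3(1) n3(2), of s y z t] hx[OF n3(1) n3(3), of s y z t]
          hx[OF n3(2) n3(1), of s y z t] hx[OF n3(2) n3(2), of s y z t] hx[OF n3(2) n3(3), of s y z t]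
          hx[OF n3(3) n3(1), of s y z t] hx[OF n3(3) n3(2), of s y z t] hx[OF n3(3) n3(3), of s y z t]
        using 2 by (simp add: algebra_simps power2_eq_square)
      from quartic_coeffs_zero(2)[OF this]
      show "h 1 1 (x, y, z, t) * h 2 2 (x, y, z, t) - h 1 2 (x, y, z, t) * h 2 1 (x, y, z, t) = k' * y ^ 2"
        using hx[of 1 1 x y z t] hx[of 1 2 x y z t] hx[of 2 1 x y z t] hx[of 2 2 x y z t] 2 by simp
    qed (rule lin; simp)+
  qed
qed

section \<open>Affine determinants of size four\<close>

lemma no_affine_det4:
  fixes N :: "'a::field_char_0 point \<Rightarrow> 'a mat"
  assumes N: "linear_mat 4 N" and B: "B \<in> carrier_mat 4 4"
    and det: "\<And>v. det (B + N v) = cubic v"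
  shows False
proof -
  obtain r P Q where r: "r \<le> 4" and PQ: "P \<in> carrier_mat 4 4" "Q \<in> carrier_mat 4 4"
    "det P \<noteq> 0" "det Q \<noteq> 0" "P * B * Q = diag_ones 4 r"
    using mat_equivalent_diag_ones[OF B] unfolding mat_equivalent_def by blast
  define H where "H v = P * N v * Q" for v
  have H: "linear_mat 4 H" unfolding H_def by (rule linear_mat_mult[OF N PQ(1,2)])
  note carr = linear_mat_carrier[OF H]
  define k where "k = det P * det Q"
  have k: "k \<noteq> 0" using PQ by (simp add: k_def)
  have det_H: "det (diag_ones 4 r + H v) = k * cubic v" for v
  proof -
    have "diag_ones 4 r + H v = P * (B + N v) * Q"
      unfolding PQ(5)[symmetric] H_def using PQ B linear_mat_carrier[OF N, of v]
      by (simp add: mult_add_distrib_mat[of _ 4 4 _ 4] add_mult_distrib_mat[of _ 4 4 _ _ 4])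
    thus ?thesis using PQ B linear_mat_carrier[OF N, of v]
      by (simp add: k_def det_mult[of _ 4] det)
  qed
  \<comment> \<open>Scaling the point by \<open>s\<close> scales \<open>H\<close> by
    \<open>s\<close> and the cubic by \<open>s ^ 3\<close>; all other coefficients in
    \<open>det_diag_ones_plus\<close> must therefore vanish.\<close>
  have det_s: "det (diag_ones 4 r + s \<cdot>\<^sub>m H v) = k * cubic v * s ^ 3" for s v
  proof (cases v)
    case (fields x y z t)
    show ?thesis unfolding fields linear_mat_scale_point[OF H, symmetric] det_H
      by (simp add: algebra_simps power_mult_distrib power_numeral_reduce)
  qed
  define n where "n i j v = H v $$ (i, j)" for i j v
  have lin: "linear_form (n i j)" if "i < 4" "j < 4" for i j
    unfolding n_def using linear_mat_entry[OF H that] .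
  consider "r = 0" | "r = 1" | "r = 2" | "r = 3" | "r = 4" using r by linarith
  thus False
  proof cases
    case 1
    have "0 + 0 * s + 0 * s ^ 2 + (- k) * s ^ 3 + det (H (0,0,1,0)) * s ^ 4 = 0" for s
      using det_s[of s "(0,0,1,0)"] 1 det_diag_ones_plus(1)[OF carr[of "(0,0,1,0)"], of s]
      by (simp add: algebra_simps)
    from quartic_coeffs_zero(4)[OF this] k show False by simp
  next
    case 2
    have "0 + 0 * s + 0 * s ^ 2 + (minor3 (H v) 1 2 3 1 2 3 - k * cubic v) * s ^ 3 + det (H v) * s ^ 4 = 0" for s v
      using det_s[of s v] 2 det_diag_ones_plus(2)[OF carr[of v], of s] by (simp add: algebra_simps)
    note * = quartic_coeffs_zero(4)[OF this]
    define G where "G v = mat 3 3 (\<lambda>(i, j). n (Suc i) (Suc j) v)" for v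
    have "linear_mat 3 G" unfolding linear_mat_def using lin by (auto simp: G_def)
    moreover have "det (G v) = k * cubic v" for v
      using *[of v] det_3[of "G v"]
      by (simp add: G_def minor3_def minor2_def n_def eval_nat_numeral)
    ultimately show False using no_linear_det3 k by blast
  next
    case 3
    have "0 + 0 * s + minor2 (H v) 2 3 2 3 * s ^ 2 +
      (minor3 (H v) 0 2 3 0 2 3 + minor3 (H v) 1 2 3 1 2 3 - k * cubic v) * s ^ 3 + det (H v) * s ^ 4 = 0" for s v
      using det_s[of s v] 3 det_diag_ones_plus(3)[OF carr[of v], of s] by (simp add: algebra_simps)
    note * = quartic_coeffs_zero(3,4)[OF this]
    have deg2: "n 2 2 v * n 3 3 v = n 2 3 v * n 3 2 v" for v
      using *(1)[of v] by (simp add: minor2_def n_def)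
    have deg3: "k * cubic v = minor3 (H v) 0 2 3 0 2 3 + minor3 (H v) 1 2 3 1 2 3" for v
      using *(2)[of v] by simp
    note no = cubic_not_in_line_ideal_squared[OF _ _ _ _ _ _ _ _ k]
    have n4: "2 < (4::nat)" "3 < (4::nat)" by simp_all
    from linear_forms_det_zero[OF lin[OF n4(1) n4(1)] lin[OF n4(1) n4(2)] lin[OF n4(2) n4(1)]
        lin[OF n4(2) n4(2)] deg2] obtain l where
      "(\<forall>v. n 2 3 v = l * n 2 2 v \<and> n 3 3 v = l * n 3 2 v) \<or>
       (\<forall>v. n 2 2 v = l * n 2 3 v \<and> n 3 2 v = l * n 3 3 v) \<or>
       (\<forall>v. n 3 2 v = l * n 2 2 v \<and> n 3 3 v = l * n 2 3 v) \<or>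
       (\<forall>v. n 2 2 v = l * n 3 2 v \<and> n 2 3 v = l * n 3 3 v)" .
    then consider "\<forall>v. n 2 3 v = l * n 2 2 v \<and> n 3 3 v = l * n 3 2 v"
      | "\<forall>v. n 2 2 v = l * n 2 3 v \<and> n 3 2 v = l * n 3 3 v"
      | "\<forall>v. n 3 2 v = l * n 2 2 v \<and> n 3 3 v = l * n 2 3 v"
      | "\<forall>v. n 2 2 v = l * n 3 2 v \<and> n 2 3 v = l * n 3 3 v" by blast
    thus False
    proof cases
      case 1
      \<comment> \<open>Subtracting \<open>l\<close> times column 2 from column 3 clears rows 2 and
        3 of the latter, so each term of the minors contains one of its two upper entries. The other
        cases follow the same pattern with columns swapped or rows for columns.\<close>
      have "k * cubic v = (n 0 3 v - l * n 0 2 v) * (n 3 2 v * n 2 0 v + n 2 2 v * (- n 3 0 v)) +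
        (n 1 3 v - l * n 1 2 v) * (n 3 2 v * n 2 1 v + n 2 2 v * (- n 3 1 v))" for v
        using 1[rule_format, of v] unfolding deg3 minor3_def minor2_def n_def by (simp add: algebra_simps)
      thus False by (rule no[rotated -1]) (intro linear_form_intros lin; simp)+
    next
      case 2
      have "k * cubic v = (n 0 2 v - l * n 0 3 v) * (n 3 3 v * (- n 2 0 v) + n 2 3 v * n 3 0 v) +
        (n 1 2 v - l * n 1 3 v) * (n 3 3 v * (- n 2 1 v) + n 2 3 v * n 3 1 v)" for v
        using 2[rule_format, of v] unfolding deg3 minor3_def minor2_def n_def by (simp add: algebra_simps)
      thus False by (rule no[rotated -1]) (intro linear_form_intros lin; simp)+
    next
      case 3
      have "k * cubic v = (n 3 0 v - l * n 2 0 v) * (n 2 3 v * n 0 2 v + n 2 2 v * (- n 0 3 v)) +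
        (n 3 1 v - l * n 2 1 v) * (n 2 3 v * n 1 2 v + n 2 2 v * (- n 1 3 v))" for v
        using 3[rule_format, of v] unfolding deg3 minor3_def minor2_def n_def by (simp add: algebra_simps)
      thus False by (rule no[rotated -1]) (intro linear_form_intros lin; simp)+
    next
      case 4
      have "k * cubic v = (n 2 0 v - l * n 3 0 v) * (n 3 3 v * (- n 0 2 v) + n 3 2 v * n 0 3 v) +
        (n 2 1 v - l * n 3 1 v) * (n 3 3 v * (- n 1 2 v) + n 3 2 v * n 1 3 v)" for v
        using 4[rule_format, of v] unfolding deg3 minor3_def minor2_def n_def by (simp add: algebra_simps)
      thus False by (rule no[rotated -1]) (intro linear_form_intros lin; simp)+
    qed
  next
    case 4
    have "0 + n 3 3 v * s + (minor2 (H v) 0 3 0 3 + minor2 (H v) 1 3 1 3 + minor2 (H v) 2 3 2 3) * s ^ 2 +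
      (minor3 (H v) 0 1 3 0 1 3 + minor3 (H v) 0 2 3 0 2 3 + minor3 (H v) 1 2 3 1 2 3 - k * cubic v) * s ^ 3 +
      det (H v) * s ^ 4 = 0" for s v
      using det_s[of s v] 4 det_diag_ones_plus(4)[OF carr[of v], of s] by (simp add: n_def algebra_simps)
    note * = quartic_coeffs_zero(2-5)[OF this]
    have z: "n 3 3 v = 0" for v using *(1)[of v] .
    have d2: "n 3 0 v * n 0 3 v + n 3 1 v * n 1 3 v + n 3 2 v * n 2 3 v = 0" for v
      using *(2)[of v] z[of v] by (simp add: minor2_def n_def algebra_simps)
    interpret bordered k "n 3 0" "n 3 1" "n 3 2" "n 0 3" "n 1 3" "n 2 3" "n 0 0" "n 0 1" "n 0 2"
      "n 1 0" "n 1 1" "n 1 2" "n 2 0" "n 2 1" "n 2 2"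
    proof
      fix v
      show "n 3 0 v * n 0 3 v + n 3 1 v * n 1 3 v + n 3 2 v * n 2 3 v = 0" by (rule d2)
      \<comment> \<open>The three minors add up to \<open>w M u\<close> minus the trace of
        \<open>M\<close> times \<open>w u\<close>; adding back the second term, which is zero,
        leaves \<open>w M u\<close>.\<close>
      have "k * cubic v = minor3 (H v) 0 1 3 0 1 3 + minor3 (H v) 0 2 3 0 2 3 + minor3 (H v) 1 2 3 1 2 3 +
          (n 0 0 v + n 1 1 v + n 2 2 v) * (n 3 0 v * n 0 3 v + n 3 1 v * n 1 3 v + n 3 2 v * n 2 3 v)"
        using *(3)[of v] d2[of v] by simp
      thus "n 3 0 v * (n 0 0 v * n 0 3 v + n 0 1 v * n 1 3 v + n 0 2 v * n 2 3 v) +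
         n 3 1 v * (n 1 0 v * n 0 3 v + n 1 1 v * n 1 3 v + n 1 2 v * n 2 3 v) +
         n 3 2 v * (n 2 0 v * n 0 3 v + n 2 1 v * n 1 3 v + n 2 2 v * n 2 3 v) = k * cubic v"
        using z[of v] by (simp add: minor3_def minor2_def n_def algebra_simps)
      show "n 3 0 v * ((n 1 1 v * n 2 2 v - n 1 2 v * n 2 1 v) * n 0 3 v +
          (n 0 2 v * n 2 1 v - n 0 1 v * n 2 2 v) * n 1 3 v + (n 0 1 v * n 1 2 v - n 0 2 v * n 1 1 v) * n 2 3 v) +
         n 3 1 v * ((n 1 2 v * n 2 0 v - n 1 0 v * n 2 2 v) * n 0 3 v +
          (n 0 0 v * n 2 2 v - n 0 2 v * n 2 0 v) * n 1 3 v + (n 0 2 v * n 1 0 v - n 0 0 v * n 1 2 v) * n 2 3 v) +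
         n 3 2 v * ((n 1 0 v * n 2 1 v - n 1 1 v * n 2 0 v) * n 0 3 v +
          (n 0 1 v * n 2 0 v - n 0 0 v * n 2 1 v) * n 1 3 v + (n 0 0 v * n 1 1 v - n 0 1 v * n 1 0 v) * n 2 3 v) = 0"
        using *(4)[of v] z[of v] unfolding det_4[OF carr]
        by (simp add: minor3_def minor2_def n_def algebra_simps)
    qed (use k in \<open>simp_all add: lin\<close>)
    show False by (rule inconsistent)
  next
    case 5
    have "diag_ones 4 4 + 0 \<cdot>\<^sub>m H 0 = (1\<^sub>m 4 :: 'a mat)"
      using carr[of 0] by (intro eq_matI) (auto simp: diag_ones_full)
    thus False using det_s[of 0 0] 5 by simp
  qed
qed

section \<open>Evaluation of polynomials and the main result\<close>

definition eval_monom :: "(nat \<Rightarrow> 'a::comm_ring_1) \<Rightarrow> (nat \<Rightarrow>\<^sub>0 nat) \<Rightarrow> 'a" where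
  "eval_monom v m = (\<Prod>i\<in>Poly_Mapping.keys m. v i ^ Poly_Mapping.lookup m i)"

definition eval_mpoly :: "(nat \<Rightarrow> 'a::comm_ring_1) \<Rightarrow> 'a mpoly \<Rightarrow> 'a" where
  "eval_mpoly v p = (\<Sum>m\<in>Poly_Mapping.keys p. Poly_Mapping.lookup p m * eval_monom v m)"

lemma eval_monom_superset:
  assumes "finite S" "Poly_Mapping.keys m \<subseteq> S"
  shows "eval_monom v m = (\<Prod>i\<in>S. v i ^ Poly_Mapping.lookup m i)"
  unfolding eval_monom_def using assms
  by (intro prod.mono_neutral_left) (auto simp: in_keys_iff)

lemma eval_monom_add: "eval_monom v (m + n) = eval_monom v m * eval_monom v n"
proof -
  let ?S = "Poly_Mapping.keys m \<union> Poly_Mapping.keys n"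
  have "Poly_Mapping.keys (m + n) \<subseteq> ?S" by (rule Poly_Mapping.keys_add)
  thus ?thesis
    by (simp add: eval_monom_superset[of ?S] lookup_add power_add prod.distrib)
qed

lemma eval_mpoly_superset:
  assumes "finite S" "Poly_Mapping.keys p \<subseteq> S"
  shows "eval_mpoly v p = (\<Sum>m\<in>S. Poly_Mapping.lookup p m * eval_monom v m)"
  unfolding eval_mpoly_def using assms
  by (intro sum.mono_neutral_left) (auto simp: in_keys_iff)

lemma eval_mpoly_add: "eval_mpoly v (p + q) = eval_mpoly v p + eval_mpoly v q"
proof -
  let ?S = "Poly_Mapping.keys p \<union> Poly_Mapping.keys q"
  have "Poly_Mapping.keys (p + q) \<subseteq> ?S" by (rule Poly_Mapping.keys_add)
  thus ?thesis
    by (simp add: eval_mpoly_superset[of ?S] lookup_add algebra_simps sum.distrib)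
qed

lemma eval_mpoly_0: "eval_mpoly v 0 = 0"
  by (simp add: eval_mpoly_def)

lemma eval_mpoly_single: "eval_mpoly v (Poly_Mapping.single m c) = c * eval_monom v m"
  by (cases "c = 0") (simp_all add: eval_mpoly_def)

lemma eval_mpoly_sum: "eval_mpoly v (\<Sum>i\<in>I. f i) = (\<Sum>i\<in>I. eval_mpoly v (f i))"
  by (induction I rule: infinite_finite_induct) (simp_all add: eval_mpoly_0 eval_mpoly_add)

lemma mpoly_as_sum: "p = (\<Sum>m\<in>Poly_Mapping.keys p. Poly_Mapping.single m (Poly_Mapping.lookup p m))"
proof (rule poly_mapping_eqI)
  fix n
  show "Poly_Mapping.lookup p n =
    Poly_Mapping.lookup (\<Sum>m\<in>Poly_Mapping.keys p. Poly_Mapping.single m (Poly_Mapping.lookup p m)) n"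
    by (simp add: lookup_sum lookup_single when_def in_keys_iff)
qed

lemma eval_mpoly_mult: "eval_mpoly v (p * q) = eval_mpoly v p * eval_mpoly v q"
proof -
  let ?s = "\<lambda>p m. Poly_Mapping.single m (Poly_Mapping.lookup p m)"
  have "p * q = (\<Sum>m\<in>Poly_Mapping.keys p. \<Sum>n\<in>Poly_Mapping.keys q. ?s p m * ?s q n)"
    by (subst mpoly_as_sum[of p], subst mpoly_as_sum[of q]) (rule sum_product)
  hence "eval_mpoly v (p * q) = (\<Sum>m\<in>Poly_Mapping.keys p. \<Sum>n\<in>Poly_Mapping.keys q.
      Poly_Mapping.lookup p m * eval_monom v m * (Poly_Mapping.lookup q n * eval_monom v n))"
    by (simp add: eval_mpoly_sum mult_single eval_mpoly_single eval_monom_add algebra_simps)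
  thus ?thesis by (simp add: eval_mpoly_def sum_product)
qed

lemma eval_mpoly_mconst: "eval_mpoly v (mconst c) = c"
  by (simp add: mconst_def eval_mpoly_single eval_monom_def)

lemma eval_mpoly_indet: "eval_mpoly v (indet i) = v i"
  by (simp add: indet_def eval_mpoly_single eval_monom_def)

text \<open>A ring homomorphism commutes with \<open>det\<close>, which carries the polynomial
  identity of a determinantal expression over to points.\<close>

lemma comm_ring_hom_eval_mpoly: "comm_ring_hom (eval_mpoly v)"
proof
  show "eval_mpoly v 1 = 1" using eval_mpoly_mconst[of v 1] by (simp add: mconst_def)
qed (simp_all add: eval_mpoly_0 eval_mpoly_add eval_mpoly_mult)

lemma mconst_simps: "mconst 0 = 0" "mconst 1 = 1" "mconst (- c) = - mconst c"
  by (simp_all add: mconst_def single_uminus)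

section \<open>The lower bound\<close>

lemma no_small_determinantal_expression:
  assumes "m \<le> 4"
  shows "\<not> determinantal_expression 4 m
    (indet 0 * indet 1 ^ 2 + indet 1 * indet 3 ^ 2 + indet 2 ^ 3 :: 'a::field_char_0 mpoly) L"
proof
  assume "determinantal_expression 4 m
    (indet 0 * indet 1 ^ 2 + indet 1 * indet 3 ^ 2 + indet 2 ^ 3 :: 'a mpoly) L"
  hence det: "det (generic_value 4 m L) = indet 0 * indet 1 ^ 2 + indet 1 * indet 3 ^ 2 + indet 2 ^ 3"
    by (simp add: determinantal_expression_def)
  define A where "A l = L (unit_vec 4 l) - L (0\<^sub>v 4)" for l
  define N where "N = (\<lambda>(x, y, z, t). mat m m (\<lambda>ij. A 0 $$ ij * x + A 1 $$ ij * y + A 2 $$ ij * z + A 3 $$ ij * t))"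
  define B where "B = mat m m (\<lambda>ij. L (0\<^sub>v 4) $$ ij)"
  have carr: "N v \<in> carrier_mat m m" "B \<in> carrier_mat m m" for v
    by (cases v, simp add: N_def) (simp add: B_def)
  have det_small: "det (B + N (x, y, z, t)) = cubic (x, y, z, t)" for x y z t
  proof -
    let ?e = "eval_mpoly (\<lambda>i. [x, y, z, t] ! i)"
    interpret comm_ring_hom ?e by (rule comm_ring_hom_eval_mpoly)
    have "map_mat ?e (generic_value 4 m L) = B + N (x, y, z, t)"
    proof (rule eq_matI)
      fix i j assume "i < dim_row (B + N (x, y, z, t))" "j < dim_col (B + N (x, y, z, t))"
      hence "i < m" "j < m" using carr(1)[of "(x, y, z, t)"] carr(2) by auto
      moreover have "(\<Sum>l<4::nat. f l) = f 0 + f 1 + f 2 + f 3" for f :: "nat \<Rightarrow> 'a mpoly"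
        using sum_lessThan4[of f] by (simp add: atLeast0LessThan)
      ultimately show "map_mat ?e (generic_value 4 m L) $$ (i, j) = (B + N (x, y, z, t)) $$ (i, j)"
        by (simp add: generic_value_def B_def N_def A_def eval_mpoly_mconst eval_mpoly_indet hom_distribs)
    qed (use carr(1)[of "(x, y, z, t)"] carr(2) in \<open>auto simp: generic_value_def\<close>)
    hence "det (B + N (x, y, z, t)) = ?e (det (generic_value 4 m L))" by (simp flip: hom_det)
    thus ?thesis by (simp add: det hom_distribs eval_mpoly_indet)
  qed
  \<comment> \<open>Padding to size 4: the identity block enters the constant part only, so the
    determinant is unchanged and the other part stays linear.\<close>
  define B' where "B' = four_block_mat B (0\<^sub>m m (4 - m)) (0\<^sub>m (4 - m) m) (1\<^sub>m (4 - m))"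
  define N' where "N' v = four_block_mat (N v) (0\<^sub>m m (4 - m)) (0\<^sub>m (4 - m) m) (0\<^sub>m (4 - m) (4 - m))" for v
  have "B' \<in> carrier_mat 4 4" using four_block_carrier_mat[OF carr(2) one_carrier_mat[of "4 - m"]] assms
    by (simp add: B'_def)
  moreover have "linear_mat 4 N'" unfolding linear_mat_def
  proof (intro conjI allI impI)
    show "N' v \<in> carrier_mat 4 4" for v
      using four_block_carrier_mat[OF carr(1) zero_carrier_mat[of "4 - m" "4 - m"]] assms
      by (simp add: N'_def)
    fix i j :: nat assume ij: "i < 4" "j < 4"
    have entry: "N' v $$ (i, j) = (if i < m \<and> j < m then N v $$ (i, j) else 0)" for v
      using ij assms carr(1)[of v] by (auto simp: N'_def)
    show "linear_form (\<lambda>v. N' v $$ (i, j))"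
    proof (cases "i < m \<and> j < m")
      case True
      thus ?thesis unfolding entry linear_form_def by (auto simp: N_def)
    next
      case False
      hence "N' v $$ (i, j) = 0" for v unfolding entry by auto
      thus ?thesis unfolding linear_form_def by (intro exI[of _ 0]) simp
    qed
  qed
  moreover have "det (B' + N' v) = cubic v" for v
  proof -
    have "B' + N' v = four_block_mat (B + N v) (0\<^sub>m m (4 - m)) (0\<^sub>m (4 - m) m) (1\<^sub>m (4 - m))"
      unfolding B'_def N'_def using carr(1)[of v] carr(2)
      by (subst add_four_block_mat[of _ m m _ "4 - m" _ "4 - m"]) auto
    moreover have "det \<dots> = det (B + N v)"
      using carr(1)[of v] carr(2) by (subst det_four_block_mat_lower_left_zero[of _ m _ "4 - m"]) auto
    ultimately show ?thesis using det_small by (cases v) simp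
  qed
  ultimately show False by (intro no_affine_det4[of N' B'])
qed

section \<open>The upper bound\<close>

lemma eq_mat5I:
  assumes "A \<in> carrier_mat 5 5" "B \<in> carrier_mat 5 5"
    and "\<And>i j. i \<in> {0, 1, 2, 3, 4} \<Longrightarrow> j \<in> {0, 1, 2, 3, 4} \<Longrightarrow> A $$ (i, j) = B $$ (i, j)"
  shows "A = B"
proof (rule eq_matI)
  have "i \<in> {0, 1, 2, 3, 4}" if "i < 5" for i :: nat using that by auto
  thus "A $$ (i, j) = B $$ (i, j)" if "i < dim_row B" "j < dim_col B" for i j
    using assms that by auto
qed (use assms in auto)

lemma determinantal_expression_size5:
  "\<exists>L. determinantal_expression 4 5
    (indet 0 * indet 1 ^ 2 + indet 1 * indet 3 ^ 2 + indet 2 ^ 3 :: 'a::field mpoly) L"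
proof -
  \<comment> \<open>The sign of \<open>- v $ 2\<close> makes the Schur complement of the identity
    block contribute \<open>+ z ^ 2\<close>.\<close>
  define M :: "'a vec \<Rightarrow> 'a mat" where "M v = mat_of_rows_list 5
    [[0, 0, 0, v $ 0, 0],
     [0, 0, 0, v $ 3, 0],
     [0, 0, 0, 0, - v $ 2],
     [0, 0, 0, v $ 2, v $ 1],
     [v $ 1, v $ 3, v $ 2, 0, 0]]" for v
  define B :: "'a mat" where "B = mat 5 5 (\<lambda>(i, j). if i = j \<and> i < 3 then 1 else 0)"
  have carr: "M v \<in> carrier_mat 5 5" for v by (rule carrier_matI) (simp_all add: M_def mat_of_rows_list_def)
  have lin: "linear_vec_mat 4 5 M"
    unfolding linear_vec_mat_def
  proof (intro conjI ballI allI)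
    show "M \<in> carrier_vec 4 \<rightarrow> carrier_mat 5 5" using carr by blast
    fix u v :: "'a vec" assume "u \<in> carrier_vec 4" "v \<in> carrier_vec 4"
    thus "M (u + v) = M u + M v"
      by (intro eq_mat5I) (auto simp: carr, auto simp: M_def mat_of_rows_list_def)
  next
    fix c and v :: "'a vec" assume "v \<in> carrier_vec 4"
    thus "M (c \<cdot>\<^sub>v v) = c \<cdot>\<^sub>m M v"
      by (intro eq_mat5I) (auto simp: carr, auto simp: M_def mat_of_rows_list_def)
  qed
  let ?L = "\<lambda>v. M v + B"
  have "affine_vec_mat 4 5 ?L" unfolding affine_vec_mat_def
    using lin by (intro exI[of _ M] bexI[of _ B]) (auto simp: B_def)
  moreover define C :: "'a mpoly mat" where "C = mat_of_rows_list 5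
    [[1, 0, 0, indet 0, 0],
     [0, 1, 0, indet 3, 0],
     [0, 0, 1, 0, - indet 2],
     [0, 0, 0, indet 2, indet 1],
     [indet 1, indet 3, indet 2, 0, 0]]"
  \<comment> \<open>The lower \<open>2 \<times> 2\<close> block has zero determinant, so \<open>F = y (x y + t\<^sup>2) + z z\<^sup>2\<close> is read off from the
     Schur complement of the \<open>3 \<times> 3\<close> identity block.\<close>
  have C: "C \<in> carrier_mat 5 5" by (rule carrier_matI) (simp_all add: C_def mat_of_rows_list_def)
  have "generic_value 4 5 ?L = C"
  proof (rule eq_mat5I)
    have sum4: "(\<Sum>l<4::nat. f l) = f 0 + f 1 + f 2 + f 3" for f :: "nat \<Rightarrow> 'a mpoly"
      using sum_lessThan4[of f] by (simp add: atLeast0LessThan)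
    fix i j :: nat assume "i \<in> {0, 1, 2, 3, 4}" "j \<in> {0, 1, 2, 3, 4}"
    thus "generic_value 4 5 ?L $$ (i, j) = C $$ (i, j)"
      by (auto simp: generic_value_def sum4 M_def B_def C_def mat_of_rows_list_def mconst_simps)
  qed (simp_all add: generic_value_def C)
  moreover have "det C = indet 0 * indet 1 ^ 2 + indet 1 * indet 3 ^ 2 + indet 2 ^ 3"
  proof -
    have sum5: "(\<Sum>l<5::nat. f l) = f 0 + f 1 + f 2 + f 3 + f 4" for f :: "nat \<Rightarrow> 'a mpoly"
      by (simp add: eval_nat_numeral add.assoc)
    have "mat_delete C 0 j \<in> carrier_mat 4 4" for j
      using mat_delete_carrier[OF C, of 0 j] by simp
    note det_delete = det_4[OF this]
    have "det C = (\<Sum>j<5. C $$ (0, j) * cofactor C 0 j)"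
      by (rule laplace_expansion_row[OF C]) simp
    thus ?thesis unfolding sum5 cofactor_def det_delete minor3_def minor2_def
      by (simp add: mat_delete_def C_def mat_of_rows_list_def algebra_simps
          power2_eq_square power3_eq_cube)
  qed
  ultimately show ?thesis unfolding determinantal_expression_def by metis
qed

theorem theorem1p8:
  fixes x y z t :: "'a::field_char_0 mpoly"
  assumes "x = indet 0" and "y = indet 1" and "z = indet 2" and "t = indet 3"
  shows "determinantal_complexity 4 (x * y ^ 2 + y * t ^ 2 + z ^ 3) = 5"
  unfolding determinantal_complexity_def assms
proof (rule Least_equality)
  show "1 \<le> (5::nat) \<and> (\<exists>L. determinantal_expression 4 5
      (indet 0 * indet 1 ^ 2 + indet 1 * indet 3 ^ 2 + indet 2 ^ 3 :: 'a mpoly) L)"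
    using determinantal_expression_size5 by simp
next
  fix m assume "1 \<le> m \<and> (\<exists>L. determinantal_expression 4 m
      (indet 0 * indet 1 ^ 2 + indet 1 * indet 3 ^ 2 + indet 2 ^ 3 :: 'a mpoly) L)"
  thus "5 \<le> m" using no_small_determinantal_expression[of m, where 'a = 'a] by fastforce
qed

end
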